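(* Let $\mu,\nu\in\mathcal{P}_1(\mathbb{R})$ satisfy $\mu\preceq_c\nu$. Let $\pi\in\Pi(\mu,\nu)$ satisfy the barycentre dispersion assumption: for all $x\in\mathbb{R}$, $$\int_{\{x_1\ge x\}}(x_2-x_1)\,\pi(dx_1,dx_2)\ge0 .$$ Then there exists a martingale measure $\pi_{mr}\in\mathcal{M}(\mu,\nu)$ such that $$\inf_{\tilde\pi\in\mathcal{M}(\mu,\nu)}W_1^{nd}(\pi,\tilde\pi)=W_1^{nd}(\pi,\pi_{mr})=\epsilon_\pi .$$
   Context: $\mathcal{P}_1(\mathbb{R})$ denotes the Borel probability measures on $\mathbb{R}$ with finite first absolute moment. $\Pi(\mu,\nu)$ is the set of probability measures on $\mathbb{R}^2$ with first marginal $\mu$ and second marginal $\nu$. For $\pi\in\mathcal{P}(\mathbb{R}^2)$, $\pi^1$ is its first marginal and $(\pi_{x_1})_{x_1\in\mathbb{R}}$ a disintegration (regular conditional distribution) of $\pi$ with respect to $\pi^1$. Martingale couplings: $$\mathcal{M}(\mu,\nu)=\Big\{\pi\in\Pi(\mu,\nu): \int(x_2-x_1)\,\pi_{x_1}(dx_2)=0\ \ \mu\text{-a.s.}\Big\}.$$ Convex order: $\mu\preceq_c\nu$ iff $\int f\,d\mu\le\int f\,d\nu$ for all convex $f:\mathbb{R}\to\mathbb{R}$. For $\pi\in\Pi(\mu,\nu)$, $$\epsilon_\pi:=\int\Big|\int(x_2-x_1)\,\pi_{x_1}(dx_2)\Big|\,\mu(dx_1).$$ The nested $1$-Wasserstein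 distance is $$W_1^{nd}(\pi,\tilde\pi)=\inf_{\gamma^1\in\Pi(\pi^1,\tilde\pi^1)}\Big(\int|x_1-y_1|\,\gamma^1(dx_1,dy_1)+\int\inf_{\gamma^2\in\Pi(\pi_{x_1},\tilde\pi_{y_1})}\int|x_2-y_2|\,\gamma^2(dx_2,dy_2)\,\gamma^1(dx_1,dy_1)\Big).$$ *)

theory Defs
  imports "HOL-Probability.Probability"
begin

definition P1 :: "real measure set" where
  "P1 = {\<mu>. prob_space \<mu> \<and> sets \<mu> = sets borel \<and> integrable \<mu> (\<lambda>x. \<bar>x\<bar>)}"

definition couplings :: "real measure \<Rightarrow> real measure \<Rightarrow> (real \<times> real) measure set" where
  "couplings \<mu> \<nu> = {\<pi>. prob_space \<pi> \<and> sets \<pi> = sets borel \<and>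
     distr \<pi> borel fst = \<mu> \<and> distr \<pi> borel snd = \<nu>}"

text \<open>
  The integral with values in \<open>[-\<infinity>, \<infinity>]\<close>. A convex function has an integrable negative part
  under every member of \<^const>\<open>P1\<close>, but its positive part may have infinite integral, in which
  case the Bochner integral would return the default value 0.
\<close>

definition ext_integral :: "'a measure \<Rightarrow> ('a \<Rightarrow> real) \<Rightarrow> ereal" where
  "ext_integral M f =
     enn2ereal (\<integral>\<^sup>+x. ennreal (f x) \<partial>M) - enn2ereal (\<integral>\<^sup>+x. ennreal (- f x) \<partial>M)"

definition convex_order :: "real measure \<Rightarrow> real measure \<Rightarrow> bool" where
  "convex_order \<mu> \<nu> \<longleftrightarrow>
     (\<forall>f :: real \<Rightarrow> real. convex_on UNIV f \<longrightarrow> ext_integral \<mu> f \<le> ext_integral \<nu> f)"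

definition is_disintegration :: "(real \<times> real) measure \<Rightarrow> (real \<Rightarrow> real measure) \<Rightarrow> bool" where
  "is_disintegration \<pi> \<kappa> \<longleftrightarrow> \<kappa> \<in> borel \<rightarrow>\<^sub>M prob_algebra borel \<and>
     (\<forall>A\<in>sets borel. \<forall>B\<in>sets borel.
        emeasure \<pi> (A \<times> B) = (\<integral>\<^sup>+x\<in>A. emeasure (\<kappa> x) B \<partial>distr \<pi> borel fst))"

text \<open>
  For a Borel probability measure \<open>\<pi>\<close> on the plane a disintegration exists and is unique up to
  a null set of the first marginal. Everything below uses \<open>disint \<pi> x\<close> only up to such null
  sets, so the choice is immaterial.
\<close>

definition disint :: "(real \<times> real) measure \<Rightarrow> real \<Rightarrow> real measure" where
  "disint \<pi> = (SOME \<kappa>. is_disintegration \<pi> \<kappa>)"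

definition martingale_couplings :: "real measure \<Rightarrow> real measure \<Rightarrow> (real \<times> real) measure set" where
  "martingale_couplings \<mu> \<nu> = {\<pi> \<in> couplings \<mu> \<nu>.
     AE x in \<mu>. has_bochner_integral (disint \<pi> x) (\<lambda>y. y - x) 0}"

definition barycentre_gap :: "(real \<times> real) measure \<Rightarrow> ennreal" where
  "barycentre_gap \<pi> =
     (\<integral>\<^sup>+x. ennreal \<bar>\<integral>y. (y - x) \<partial>disint \<pi> x\<bar> \<partial>distr \<pi> borel fst)"

definition wasserstein1 :: "real measure \<Rightarrow> real measure \<Rightarrow> ennreal" where
  "wasserstein1 \<mu> \<nu> = (INF \<gamma>\<in>couplings \<mu> \<nu>. \<integral>\<^sup>+(x, y). ennreal \<bar>x - y\<bar> \<partial>\<gamma>)"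

definition nested_wasserstein1 :: "(real \<times> real) measure \<Rightarrow> (real \<times> real) measure \<Rightarrow> ennreal" where
  "nested_wasserstein1 \<pi> \<pi>' =
     (INF \<gamma>\<in>couplings (distr \<pi> borel fst) (distr \<pi>' borel fst).
        (\<integral>\<^sup>+(x, y). ennreal \<bar>x - y\<bar> \<partial>\<gamma>) +
        (\<integral>\<^sup>+(x, y). wasserstein1 (disint \<pi> x) (disint \<pi>' y) \<partial>\<gamma>))"

definition barycentre_dispersion :: "(real \<times> real) measure \<Rightarrow> bool" where
  "barycentre_dispersion \<pi> \<longleftrightarrow>
     (\<forall>x::real. 0 \<le> (LINT z:{z. x \<le> fst z}|\<pi>. snd z - fst z))"

end

theory Submission
  imports Defs
begin

text \<open>
  Write \<open>\<kappa> x\<close> for the disintegration of \<open>\<pi>\<close> and \<open>b x\<close> for the mean of \<open>\<kappa> x\<close> minus \<open>x\<close>. For every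
  coupling, \<open>\<bar>x - y\<bar>\<close> plus the transport cost from \<open>\<kappa> x\<close> to a kernel with mean \<open>y\<close> is at least
  \<open>\<bar>b x\<bar>\<close>, so the barycentre gap is a lower bound.

  It is attained by exchanging mass between kernels. As \<open>b\<close> has \<open>\<mu>\<close>-integral zero, dispersion says
  that the probability measure proportional to the negative part of \<open>b \<mu>\<close> is stochastically smaller
  than the one proportional to the positive part, so the quantile coupling pairs points \<open>x \<le> x'\<close>
  with \<open>b x < 0 < b x'\<close>. For such a pair draw \<open>y\<close> from \<open>\<kappa> x\<close> and \<open>z\<close> from \<open>\<kappa> x'\<close> independently and, if
  \<open>y < z\<close>, swap them with a probability chosen so that the mean of the kernel at \<open>x\<close> rises by exactly
  \<open>\<bar>b x\<bar>\<close>. This probability is at most one because the expectation of the positive part of \<open>z - y\<close>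
  is at least the difference \<open>(x' + b x') - (x + b x)\<close> of the means. The mass leaving one kernel
  enters the other, so the second marginal stays \<open>\<nu>\<close>; all the mass of a given kernel moves in the
  same direction, so the transport cost equals the change of the mean, namely \<open>\<bar>b x\<bar>\<close>.
\<close>

subsection \<open>Disintegrations\<close>

lemma measurable_fst_borel [measurable]:
  "fst \<in> (borel :: ('a::second_countable_topology \<times> 'b::second_countable_topology) measure) \<rightarrow>\<^sub>M borel"
  by (simp add: borel_prod[symmetric])

lemma measurable_snd_borel [measurable]:
  "snd \<in> (borel :: ('a::second_countable_topology \<times> 'b::second_countable_topology) measure) \<rightarrow>\<^sub>M borel"
  by (simp add: borel_prod[symmetric])

section \<open>Rational half-lines and uniqueness of disintegrations\<close>

lemma rational_sequence_decreasing_to: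
  fixes t :: real
  shows "\<exists>q :: nat \<Rightarrow> real. range q \<subseteq> \<rat> \<and> decseq q \<and> (\<forall>n. t < q n) \<and> (\<Union>n. {q n<..}) = {t<..}"
proof (intro exI conjI allI)
  \<comment> \<open>\<open>q n\<close> is the least multiple of \<open>2^-n\<close> strictly above
    \<open>t\<close>; floor plus one, rather than a ceiling, keeps \<open>t < q n\<close> when
    \<open>t\<close> is itself dyadic.\<close>
  define q where "q n = real_of_int (\<lfloor>2 ^ n * t\<rfloor> + 1) / 2 ^ n" for n
  show "range q \<subseteq> \<rat>"
    unfolding q_def by (intro image_subsetI Rats_divide Rats_of_int Rats_power) auto
  show "decseq q"
  proof (rule decseq_SucI)
    fix n
    have "\<lfloor>2 ^ Suc n * t\<rfloor> + 1 \<le> 2 * (\<lfloor>2 ^ n * t\<rfloor> + 1)"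
      by simp linarith
    then have "real_of_int (\<lfloor>2 ^ Suc n * t\<rfloor> + 1) \<le> 2 * real_of_int (\<lfloor>2 ^ n * t\<rfloor> + 1)"
      by linarith
    then have "q (Suc n) \<le> (2 * real_of_int (\<lfloor>2 ^ n * t\<rfloor> + 1)) / 2 ^ Suc n"
      unfolding q_def by (intro divide_right_mono) auto
    also have "\<dots> = q n"
      unfolding q_def by (simp add: field_simps)
    finally show "q (Suc n) \<le> q n" .
  qed
  show t_less: "t < q n" for n
    unfolding q_def by (simp add: field_simps) linarith
  show "(\<Union>n. {q n<..}) = {t<..}"
  proof (intro set_eqI iffI)
    fix x assume "x \<in> (\<Union>n. {q n<..})"
    then obtain n where n: "q n < x" by auto
    with t_less[of n] show "x \<in> {t<..}" by simp
  next
    fix x assume "x \<in> {t<..}"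
    then obtain n where n: "inverse (2 ^ n) < x - t"
      using reals_power_lt_ex[of "x - t" 2] by (auto simp: power_one_over inverse_eq_divide)
    have "q n \<le> t + inverse (2 ^ n)"
      unfolding q_def by (simp add: field_simps)
    with n have "q n < x" by simp
    then show "x \<in> (\<Union>n. {q n<..})" by auto
  qed
qed

text \<open>A half-line is the increasing union of half-lines with rational left ends, so continuity
  from below suffices. Only countably many conditions remain, and these can hold simultaneously off
  one null set.\<close>

lemma measure_eqI_greaterThan_Rats:
  fixes M N :: "real measure"
  assumes sets: "sets M = sets borel" "sets N = sets borel"
    and fin: "\<And>x. emeasure M {x <..} < \<infinity>"
    and eq: "\<And>q. q \<in> \<rat> \<Longrightarrow> emeasure M {q <..} = emeasure N {q <..}"
  shows "M = N"
proof (rule measure_eqI_lessThan[OF sets fin])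
  fix t :: real
  obtain q :: "nat \<Rightarrow> real" where "range q \<subseteq> \<rat>"
      and q: "decseq q" "\<And>n. t < q n" "(\<Union>n. {q n<..}) = {t<..}"
    using rational_sequence_decreasing_to[of t] by auto
  then have q_Rats: "\<And>n. q n \<in> \<rat>" by auto
  have "incseq (\<lambda>n. {q n<..})"
    using q(1) by (auto simp: monotone_def intro: le_less_trans)
  then have *: "emeasure K {t<..} = (SUP n. emeasure K {q n<..})" if "sets K = sets borel" for K
    using SUP_emeasure_incseq[OF _ \<open>incseq (\<lambda>n. {q n<..})\<close>, of K] that unfolding q(3)
    by (simp add: image_subset_iff)
  show "emeasure M {t<..} = emeasure N {t<..}"
    using *[OF sets(1)] *[OF sets(2)] eq[OF q_Rats] by simp
qed

text \<open>Splitting each set along \<open>g < f\<close> shows that \<open>max f g\<close> has the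
  same integrals as \<open>g\<close>; both are densities of one finite measure and so agree almost
  everywhere.\<close>

lemma (in finite_measure) AE_le_of_nn_set_integral_le:
  fixes f g :: "'a \<Rightarrow> ennreal"
  assumes [measurable]: "f \<in> borel_measurable M" "g \<in> borel_measurable M"
    and fin: "(\<integral>\<^sup>+x. g x \<partial>M) < \<infinity>"
    and le: "\<And>A. A \<in> sets M \<Longrightarrow> (\<integral>\<^sup>+x\<in>A. f x \<partial>M) \<le> (\<integral>\<^sup>+x\<in>A. g x \<partial>M)"
  shows "AE x in M. f x \<le> g x"
proof -
  have "AE x in M. max (f x) (g x) = g x"
  proof (rule density_unique_finite_measure)
    fix A assume A[measurable]: "A \<in> sets M"
    let ?N = "{x \<in> space M. g x < f x}"
    have "(\<integral>\<^sup>+x. max (f x) (g x) * indicator A x \<partial>M) =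
        (\<integral>\<^sup>+x\<in>A \<inter> ?N. f x \<partial>M) + (\<integral>\<^sup>+x\<in>A - ?N. g x \<partial>M)"
      by (subst nn_integral_add[symmetric])
         (auto intro!: nn_integral_cong simp: indicator_def max_def split: if_splits)
    also have "\<dots> \<le> (\<integral>\<^sup>+x\<in>A \<inter> ?N. g x \<partial>M) + (\<integral>\<^sup>+x\<in>A - ?N. g x \<partial>M)"
      by (intro add_mono le) auto
    also have "\<dots> = (\<integral>\<^sup>+x. g x * indicator A x \<partial>M)"
      by (subst nn_integral_add[symmetric])
         (auto intro!: nn_integral_cong simp: indicator_def split: if_splits)
    finally show "(\<integral>\<^sup>+x. max (f x) (g x) * indicator A x \<partial>M) = (\<integral>\<^sup>+x. g x * indicator A x \<partial>M)"
      by (rule antisym) (intro nn_integral_mono mult_right_mono, auto)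
  qed auto
  then show ?thesis
    by eventually_elim (metis max.cobounded1)
qed

text \<open>For fixed \<open>q\<close> both kernels give densities of the measure sending
  \<open>A\<close> to the mass of \<open>A \<times> {q<..}\<close>. This allows a constructed kernel
  to stand in for the arbitrary choice made by \<open>disint\<close>.\<close>

lemma is_disintegration_unique:
  assumes "is_disintegration \<pi> \<kappa>" "is_disintegration \<pi> \<kappa>'"
    and "prob_space \<pi>" "sets \<pi> = sets borel"
  shows "AE x in distr \<pi> borel fst. \<kappa> x = \<kappa>' x"
proof -
  interpret \<pi>: prob_space \<pi> by fact
  let ?\<mu> = "distr \<pi> borel fst"
  have [measurable]: "fst \<in> \<pi> \<rightarrow>\<^sub>M borel"
    using assms(4) by (simp add: measurable_cong_sets[OF assms(4) refl])
  interpret \<mu>: prob_space ?\<mu> by (intro \<pi>.prob_space_distr) simp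
  note d = assms(1,2)[unfolded is_disintegration_def]
  have meas[measurable]: "\<kappa> \<in> borel \<rightarrow>\<^sub>M prob_algebra borel" "\<kappa>' \<in> borel \<rightarrow>\<^sub>M prob_algebra borel"
    using d by auto
  note [measurable] = meas[THEN measurable_prob_algebraD]
  have "AE x in ?\<mu>. \<forall>q\<in>\<rat>. emeasure (\<kappa> x) {q<..} = emeasure (\<kappa>' x) {q<..}"
  proof (subst AE_ball_countable)
    show "\<forall>q\<in>\<rat>. AE x in ?\<mu>. emeasure (\<kappa> x) {q<..} = emeasure (\<kappa>' x) {q<..}"
    proof (intro ballI \<mu>.density_unique_finite_measure)
      fix q A assume "A \<in> sets ?\<mu>"
      then have A: "A \<in> sets borel" by simp
      note e = conjunct2[THEN bspec[OF _ A], THEN bspec[of _ _ "{q<..}"], OF _ greaterThan_borel]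
      show "(\<integral>\<^sup>+ x\<in>A. emeasure (\<kappa> x) {q<..} \<partial>?\<mu>) = (\<integral>\<^sup>+ x\<in>A. emeasure (\<kappa>' x) {q<..} \<partial>?\<mu>)"
        using e[OF d(1)] e[OF d(2)] by (rule trans[OF sym])
    qed measurable
  qed (rule countable_rat)
  then show ?thesis
  proof eventually_elim
    case (elim x)
    have k: "prob_space (\<kappa> x)" "sets (\<kappa> x) = sets borel" "sets (\<kappa>' x) = sets borel"
      using meas[THEN measurable_space, of x] by (auto simp: space_prob_algebra)
    interpret k: prob_space "\<kappa> x" by fact
    show ?case
      using elim k by (intro measure_eqI_greaterThan_Rats) (auto simp: k.emeasure_eq_measure)
  qed
qed

text \<open>Rectangles are an intersection-stable generator, so the defining identity makes
  \<open>\<pi>\<close> the mixture, over its first marginal, of the \<open>\<kappa> x\<close> placed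
  on the vertical lines. Integrals against a mixture are iterated integrals.\<close>

lemma nn_integral_is_disintegration:
  assumes d: "is_disintegration \<pi> \<kappa>" and "prob_space \<pi>" "sets \<pi> = sets borel"
    and f[measurable]: "f \<in> borel_measurable borel"
  shows "(\<integral>\<^sup>+z. f z \<partial>\<pi>) = (\<integral>\<^sup>+x. \<integral>\<^sup>+y. f (x, y) \<partial>\<kappa> x \<partial>distr \<pi> borel fst)"
proof -
  interpret \<pi>: prob_space \<pi> by fact
  let ?\<mu> = "distr \<pi> borel fst"
  have [measurable]: "fst \<in> \<pi> \<rightarrow>\<^sub>M borel"
    using assms(3) by (simp add: measurable_cong_sets[OF assms(3) refl])
  interpret \<mu>: prob_space ?\<mu> by (intro \<pi>.prob_space_distr) simp
  have \<kappa>[measurable]: "\<kappa> \<in> borel \<rightarrow>\<^sub>M prob_algebra borel"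
    using d by (auto simp: is_disintegration_def)
  note [measurable] = \<kappa>[THEN measurable_prob_algebraD]
  have k: "prob_space (\<kappa> x)" "sets (\<kappa> x) = sets borel" for x
    using \<kappa>[THEN measurable_space, of x] by (auto simp: space_prob_algebra)
  let ?K = "\<lambda>x. distr (\<kappa> x) borel (Pair x)"
  have K: "?K \<in> borel \<rightarrow>\<^sub>M subprob_algebra borel"
  proof (rule measurable_distr2)
    show "case_prod Pair \<in> borel \<Otimes>\<^sub>M borel \<rightarrow>\<^sub>M (borel :: (real \<times> real) measure)"
      unfolding borel_prod[symmetric] by measurable
    show "\<kappa> \<in> borel \<rightarrow>\<^sub>M subprob_algebra borel" by measurable
  qed
  have p[measurable]: "Pair x \<in> \<kappa> x \<rightarrow>\<^sub>M borel" for x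
    by (simp add: measurable_cong_sets[OF k(2) refl])
  have "\<pi> = ?\<mu> \<bind> ?K"
  proof (rule measure_eqI_generator_eq[where A = "\<lambda>_. UNIV" and \<Omega> = UNIV])
    let ?E = "{a \<times> b | a b. a \<in> sets (borel :: real measure) \<and> b \<in> sets (borel :: real measure)}"
    show "Int_stable ?E" using Int_stable_pair_measure_generator .
    have b: "sets (borel :: (real \<times> real) measure) = sigma_sets UNIV ?E"
      unfolding borel_prod[symmetric] sets_pair_measure by simp
    then show "sets \<pi> = sigma_sets UNIV ?E"
      using assms(3) by simp
    have "sets (?\<mu> \<bind> ?K) = sets borel"
      by (rule sets_bind) auto
    then show "sets (?\<mu> \<bind> ?K) = sigma_sets UNIV ?E"
      using b by simp
    show "emeasure \<pi> X = emeasure (?\<mu> \<bind> ?K) X" if "X \<in> ?E" for X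
    proof -
      from that obtain a b where X: "X = a \<times> b"
        and [measurable]: "a \<in> sets borel" "b \<in> sets borel" by auto
      have "emeasure (?\<mu> \<bind> ?K) X = (\<integral>\<^sup>+x. emeasure (?K x) X \<partial>?\<mu>)"
        using K X by (intro emeasure_bind) (auto simp: borel_prod[symmetric])
      also have "\<dots> = (\<integral>\<^sup>+x. emeasure (\<kappa> x) b * indicator a x \<partial>?\<mu>)"
      proof (intro nn_integral_cong)
        fix x
        have "emeasure (?K x) X = emeasure (\<kappa> x) (Pair x -` X \<inter> space (\<kappa> x))"
          using X by (intro emeasure_distr) (auto simp: borel_prod[symmetric])
        also have "Pair x -` X \<inter> space (\<kappa> x) = (if x \<in> a then b else {})"
          using X sets_eq_imp_space_eq[OF k(2)] by auto
        finally show "emeasure (?K x) X = emeasure (\<kappa> x) b * indicator a x"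
          by simp
      qed
      also have "\<dots> = emeasure \<pi> X"
        using d X unfolding is_disintegration_def by auto
      finally show ?thesis by simp
    qed
    show "?E \<subseteq> Pow UNIV" "range (\<lambda>_::nat. UNIV) \<subseteq> ?E" "(\<Union>i::nat. UNIV) = UNIV"
      by (auto intro!: exI[of _ UNIV])
    show "emeasure \<pi> UNIV \<noteq> \<infinity>" for i :: nat
      by simp
  qed
  then have "(\<integral>\<^sup>+z. f z \<partial>\<pi>) = (\<integral>\<^sup>+z. f z \<partial>(?\<mu> \<bind> ?K))" by simp
  also have "\<dots> = (\<integral>\<^sup>+x. \<integral>\<^sup>+z. f z \<partial>?K x \<partial>?\<mu>)"
    using K by (intro nn_integral_bind[where B = borel]) auto
  also have "\<dots> = (\<integral>\<^sup>+x. \<integral>\<^sup>+y. f (x, y) \<partial>\<kappa> x \<partial>?\<mu>)"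
    by (simp add: nn_integral_distr)
  finally show ?thesis .
qed

lemma is_disintegrationD:
  assumes "is_disintegration \<pi> \<kappa>"
  shows "\<kappa> \<in> borel \<rightarrow>\<^sub>M prob_algebra borel" "\<kappa> \<in> borel \<rightarrow>\<^sub>M subprob_algebra borel"
    "prob_space (\<kappa> x)" "sets (\<kappa> x) = sets borel" "space (\<kappa> x) = UNIV"
proof -
  show k: "\<kappa> \<in> borel \<rightarrow>\<^sub>M prob_algebra borel"
    using assms by (simp add: is_disintegration_def)
  then show "\<kappa> \<in> borel \<rightarrow>\<^sub>M subprob_algebra borel" by (rule measurable_prob_algebraD)
  from k[THEN measurable_space, of x] show "prob_space (\<kappa> x)" and s: "sets (\<kappa> x) = sets borel"
    by (auto simp: space_prob_algebra)
  from s show "space (\<kappa> x) = UNIV" by (simp add: sets_eq_imp_space_eq)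
qed

text \<open>The Radon-Nikodym derivative is the conditional probability of \<open>S\<close> given
  the first coordinate. Restricting \<open>\<pi>\<close> to \<open>S\<close> only lowers it, whence
  the absolute continuity.\<close>

lemma nn_set_integral_RN_deriv_fst_marginal:
  fixes \<pi> :: "(real \<times> real) measure"
  assumes "prob_space \<pi>" "sets \<pi> = sets borel" and S: "S \<in> sets borel" and A: "A \<in> sets borel"
  defines "\<mu> \<equiv> distr \<pi> borel fst"
  shows "(\<integral>\<^sup>+x\<in>A. RN_deriv \<mu> (distr (density \<pi> (indicator S)) borel fst) x \<partial>\<mu>)
    = emeasure \<pi> ((A \<times> UNIV) \<inter> S)"
proof -
  interpret \<pi>: prob_space \<pi> by fact
  have f[measurable]: "fst \<in> \<pi> \<rightarrow>\<^sub>M borel"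
    by (simp add: measurable_cong_sets[OF assms(2) refl])
  interpret \<mu>: prob_space \<mu> unfolding \<mu>_def by (rule \<pi>.prob_space_distr) simp
  let ?N = "distr (density \<pi> (indicator S)) borel fst"
  have S': "S \<in> sets \<pi>" using S assms(2) by simp
  have AU: "A \<times> UNIV \<in> sets \<pi>"
    using A assms(2) by (simp add: borel_prod[symmetric])
  have sp: "space \<pi> = UNIV" using assms(2) by (simp add: sets_eq_imp_space_eq)
  have N: "emeasure ?N B = emeasure \<pi> ((B \<times> UNIV) \<inter> S)" if "B \<in> sets borel" for B
  proof -
    have BU: "fst -` B = B \<times> UNIV" "B \<times> UNIV \<in> sets \<pi>"
      using that assms(2) by (auto simp: borel_prod[symmetric])
    have "emeasure ?N B = emeasure (density \<pi> (indicator S)) (B \<times> UNIV)"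
      using that sp by (subst emeasure_distr) (auto simp: BU)
    also have "\<dots> = emeasure \<pi> ((B \<times> UNIV) \<inter> S)"
      using emeasure_restricted[OF S' BU(2)] by (simp add: Int_commute)
    finally show ?thesis .
  qed
  have "absolutely_continuous \<mu> ?N"
    unfolding absolutely_continuous_def
  proof (intro subsetI)
    fix B assume "B \<in> null_sets \<mu>"
    then have B: "B \<in> sets borel" and 0: "emeasure \<mu> B = 0"
      by (auto simp: null_sets_def \<mu>_def)
    have BU: "fst -` B = B \<times> UNIV" "B \<times> UNIV \<in> sets \<pi>"
      using B assms(2) by (auto simp: borel_prod[symmetric])
    have "emeasure \<pi> (B \<times> UNIV) = 0"
      using 0 B BU sp unfolding \<mu>_def by (subst (asm) emeasure_distr) (auto simp: BU(1))
    then have "emeasure \<pi> ((B \<times> UNIV) \<inter> S) = 0"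
      using emeasure_mono[of "(B \<times> UNIV) \<inter> S" "B \<times> UNIV" \<pi>] BU by simp
    with N[OF B] B show "B \<in> null_sets ?N"
      by (auto simp: null_sets_def)
  qed
  then have "density \<mu> (RN_deriv \<mu> ?N) = ?N"
    by (rule \<mu>.density_RN_deriv) (simp add: \<mu>_def)
  then have "emeasure ?N A = emeasure (density \<mu> (RN_deriv \<mu> ?N)) A" by simp
  also have "\<dots> = (\<integral>\<^sup>+x\<in>A. RN_deriv \<mu> ?N x \<partial>\<mu>)"
    using A by (intro emeasure_density) (auto simp: \<mu>_def)
  finally show ?thesis using N[OF A] by simp
qed

section \<open>Existence of disintegrations through conditional quantile functions\<close>

abbreviation unit_lborel :: "real measure" where
  "unit_lborel \<equiv> restrict_space lborel {0<..<1}"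

lemma prob_space_unit_lborel: "prob_space unit_lborel"
  by (auto simp: space_restrict_space emeasure_restrict_space intro!: prob_spaceI)

lemma emeasure_unit_lborel_less:
  assumes "c \<le> 1"
  shows "emeasure unit_lborel {u \<in> space unit_lborel. ennreal u < c} = c"
proof -
  obtain r where c: "c = ennreal r" and r: "0 \<le> r" "r \<le> 1"
    using assms by (cases c) (auto simp: top_unique)
  have "{u \<in> space unit_lborel. ennreal u < c} = {0<..<r}"
    unfolding c using r by (auto simp: space_restrict_space ennreal_less_iff)
  then have "emeasure unit_lborel {u \<in> space unit_lborel. ennreal u < c} = emeasure lborel {0<..<r}"
    using r by (simp add: emeasure_restrict_space greaterThanLessThan_subseteq_greaterThanLessThan)
  then show ?thesis using r c by simp
qed

text \<open>Conditional tail probabilities are Radon-Nikodym derivatives; they are used at rational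
  thresholds and inverted to a quantile function. Feeding a uniform variable into it yields a
  probability measure at every \<open>x\<close>, even where the derivatives fail to be
  monotone.\<close>

theorem is_disintegration_exists:
  assumes "prob_space \<pi>" "sets \<pi> = sets borel"
  shows "\<exists>\<kappa>. is_disintegration \<pi> \<kappa>"
proof -
  interpret \<pi>: prob_space \<pi> by fact
  define \<mu> where "\<mu> = distr \<pi> borel fst"
  have f[measurable]: "fst \<in> \<pi> \<rightarrow>\<^sub>M borel" "snd \<in> \<pi> \<rightarrow>\<^sub>M borel"
    by (simp_all add: measurable_cong_sets[OF assms(2) refl])
  have sp: "space \<pi> = UNIV" using assms(2) by (simp add: sets_eq_imp_space_eq)
  interpret \<mu>: prob_space \<mu> unfolding \<mu>_def by (rule \<pi>.prob_space_distr) simp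
  have s\<mu>[measurable_cong]: "sets \<mu> = sets borel" by (simp add: \<mu>_def)
  \<comment> \<open>\<open>arctan\<close> maps the second coordinate into
    \<open>(-pi/2, pi/2)\<close>, inside \<open>(-2, 2)\<close>, so that quantiles are bounded;
    \<open>tan\<close> undoes this at the end.\<close>
  define S where "S q = {z :: real \<times> real. q < arctan (snd z)}" for q :: real
  have S[measurable]: "S q \<in> sets borel" for q
    unfolding S_def by measurable
  have S\<pi>[measurable]: "S q \<in> sets \<pi>" for q
    by (simp add: assms(2))
  have AU[measurable]: "A \<times> UNIV \<in> sets \<pi>" if "A \<in> sets borel" for A
    using that assms(2) by (simp add: borel_prod[symmetric])
  define F where "F q = RN_deriv \<mu> (distr (density \<pi> (indicator (S q))) borel fst)" for q
  have Fm: "F q \<in> borel_measurable \<mu>" for q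
    unfolding F_def by simp
  then have F[measurable]: "F q \<in> borel_measurable borel" for q
    by (simp add: measurable_cong_sets[OF s\<mu> refl])
  have FA: "(\<integral>\<^sup>+x\<in>A. F q x \<partial>\<mu>) = emeasure \<pi> ((A \<times> UNIV) \<inter> S q)" if "A \<in> sets borel" for A q
    unfolding F_def \<mu>_def by (rule nn_set_integral_RN_deriv_fst_marginal[OF assms S that])
  have fin: "(\<integral>\<^sup>+x. F q x \<partial>\<mu>) < \<infinity>" for q
    using FA[of UNIV q] by (simp add: \<pi>.emeasure_eq_measure)
  have mono: "AE x in \<mu>. F r x \<le> F q x" if "q \<le> r" for q r
  proof (rule \<mu>.AE_le_of_nn_set_integral_le[OF Fm Fm fin])
    fix A assume "A \<in> sets \<mu>"
    then have A[measurable]: "A \<in> sets borel" by (simp add: s\<mu>)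
    show "(\<integral>\<^sup>+x\<in>A. F r x \<partial>\<mu>) \<le> (\<integral>\<^sup>+x\<in>A. F q x \<partial>\<mu>)"
      unfolding FA[OF A] using that by (intro emeasure_mono sets.Int AU[OF A] S\<pi>) (auto simp: S_def)
  qed
  have le1: "AE x in \<mu>. F q x \<le> 1" for q
  proof (rule \<mu>.AE_le_of_nn_set_integral_le[OF Fm])
    fix A assume "A \<in> sets \<mu>"
    then have A[measurable]: "A \<in> sets borel" by (simp add: s\<mu>)
    have "(\<integral>\<^sup>+x\<in>A. 1 \<partial>\<mu>) = emeasure \<pi> (A \<times> UNIV)"
      using A sp by (auto simp: \<mu>_def emeasure_distr intro!: arg_cong[where f = "emeasure \<pi>"])
    then show "(\<integral>\<^sup>+x\<in>A. F q x \<partial>\<mu>) \<le> (\<integral>\<^sup>+x\<in>A. 1 \<partial>\<mu>)"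
      unfolding FA[OF A] by (auto intro!: emeasure_mono)
  qed (auto simp: \<mu>.emeasure_space_1)

  \<comment> \<open>\<open>Q x\<close> is the conditional quantile function of \<open>arctan \<circ> snd\<close>; clamping the index to
    \<open>[-2, 2]\<close> keeps the supremum bounded on the null set where \<open>F\<close> misbehaves.\<close>
  define Q where "Q z = (SUP q\<in>\<rat>. if ennreal (snd z) < F q (fst z) then max (-2) (min 2 q) else -2)"
    for z :: "real \<times> real"
  have bdd: "bdd_above ((\<lambda>q. if ennreal (snd z) < F q (fst z) then max (-2) (min 2 q) else -2) ` \<rat>)" for z
    by (intro bdd_aboveI[where M = 2]) auto
  have Q[measurable]: "Q \<in> borel_measurable borel"
    unfolding Q_def by (rule borel_measurable_cSUP[OF countable_rat _ bdd]) measurable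
  \<comment> \<open>The Galois relation between a quantile function and its tail function. For
    \<open>-2 \<le> t < 2\<close> the clamping leaves no trace in the condition.\<close>
  have Q_gt: "t < Q (x, u) \<longleftrightarrow> t < -2 \<or> t < 2 \<and> (\<exists>q\<in>\<rat>. t < q \<and> ennreal u < F q x)" for t x u
  proof -
    have "t < Q (x, u) \<longleftrightarrow> (\<exists>q\<in>\<rat>. t < (if ennreal u < F q x then max (-2) (min 2 q) else -2))"
      unfolding Q_def by (subst less_cSUP_iff[OF _ bdd]) (auto intro: Rats_0)
    also have "\<dots> \<longleftrightarrow> t < -2 \<or> t < 2 \<and> (\<exists>q\<in>\<rat>. t < q \<and> ennreal u < F q x)"
    proof -
      have "t < (if c then max (-2) (min 2 q) else -2) \<longleftrightarrow> t < -2 \<or> t < 2 \<and> t < q \<and> c" for c q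
        by auto
      then show ?thesis by (auto intro: Rats_0)
    qed
    finally show ?thesis .
  qed
  have Qx[measurable]: "(\<lambda>u. Q (x, u)) \<in> unit_lborel \<rightarrow>\<^sub>M borel" for x
    by (intro measurable_restrict_space1 measurable_compose[OF _ Q])
       (auto simp: borel_prod[symmetric])
  define K where "K x = distr unit_lborel borel (\<lambda>u. Q (x, u))" for x
  have K_prob: "prob_space (K x)" for x
    unfolding K_def by (rule prob_space.prob_space_distr[OF prob_space_unit_lborel Qx])
  have [measurable]: "(\<lambda>u. u) \<in> unit_lborel \<rightarrow>\<^sub>M borel"
    by (intro measurable_restrict_space1) auto
  have K[measurable]: "K \<in> borel \<rightarrow>\<^sub>M subprob_algebra borel"
    unfolding K_def
  proof (rule measurable_distr2[where M = unit_lborel])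
    have "(\<lambda>z. Q (fst z, snd z)) \<in> borel \<Otimes>\<^sub>M unit_lborel \<rightarrow>\<^sub>M borel"
      by (intro measurable_compose[OF _ Q]) (unfold borel_prod[symmetric], measurable)
    then show "(\<lambda>(x, u). Q (x, u)) \<in> borel \<Otimes>\<^sub>M unit_lborel \<rightarrow>\<^sub>M borel"
      by (simp add: case_prod_unfold)
    show "(\<lambda>x. unit_lborel) \<in> borel \<rightarrow>\<^sub>M subprob_algebra unit_lborel"
      by (intro measurable_const prob_space.M_in_subprob prob_space_unit_lborel)
  qed
  have K_emeasure: "emeasure (K x) {t<..} = emeasure unit_lborel {u \<in> space unit_lborel. t < Q (x, u)}"
    for x t
    unfolding K_def by (subst emeasure_distr) (auto intro!: arg_cong[where f = "emeasure _"])
  have AE: "AE x in \<mu>. \<forall>r\<in>\<rat>. \<forall>q\<in>\<rat>. F q x \<le> 1 \<and> (q \<le> r \<longrightarrow> F r x \<le> F q x)"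
    using mono le1 by (simp add: AE_ball_countable countable_rat AE_impI)
  \<comment> \<open>The identity for half-lines. For \<open>t\<close> outside \<open>[-2, 2)\<close>
    it is trivial, because all values of \<open>arctan\<close> lie inside.\<close>
  have cut: "(\<integral>\<^sup>+x\<in>A. emeasure (K x) {t<..} \<partial>\<mu>) = emeasure \<pi> ((A \<times> UNIV) \<inter> S t)"
    if A[measurable]: "A \<in> sets borel" for A t
  proof (cases "t < -2 \<or> 2 \<le> t")
    case True
    then show ?thesis
    proof
      assume t: "t < -2"
      have "S t = UNIV"
        using t arctan_lbound pi_less_4 unfolding S_def by (auto intro: less_trans[of t "-(pi / 2)"])
      moreover have "emeasure (K x) {t<..} = 1" for x
        using t prob_space.emeasure_space_1[OF prob_space_unit_lborel]
        by (simp only: K_emeasure Q_gt simp_thms Collect_mem_eq)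
      moreover have "(\<integral>\<^sup>+x\<in>A. 1 \<partial>\<mu>) = emeasure \<pi> (A \<times> UNIV)"
        using A sp by (auto simp: \<mu>_def emeasure_distr intro!: arg_cong[where f = "emeasure \<pi>"])
      ultimately show ?thesis by simp
    next
      assume t: "2 \<le> t"
      have "arctan y < t" for y
        using t arctan_ubound[of y] pi_less_4 by linarith
      then have "S t = {}"
        unfolding S_def by (auto simp: not_less less_imp_le)
      moreover have "emeasure (K x) {t<..} = 0" for x
        using t by (simp add: K_emeasure Q_gt)
      ultimately show ?thesis by simp
    qed
  next
    case False
    obtain q :: "nat \<Rightarrow> real" where "range q \<subseteq> \<rat>"
      and q: "decseq q" "\<And>n. t < q n" "(\<Union>n. {q n<..}) = {t<..}"
    using rational_sequence_decreasing_to[of t] by auto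
  then have q_Rats: "\<And>n. q n \<in> \<rat>" by auto
    have "(\<integral>\<^sup>+x\<in>A. emeasure (K x) {t<..} \<partial>\<mu>) = (\<integral>\<^sup>+x. (SUP n. F (q n) x * indicator A x) \<partial>\<mu>)"
    proof (rule nn_integral_cong_AE, use AE in eventually_elim)
      case (elim x)
      \<comment> \<open>Monotonicity in the threshold, valid off one null set for all rationals at
        once, reduces the rationals above \<open>t\<close> to the sequence
        \<open>q n\<close>.\<close>
      have "(\<exists>r\<in>\<rat>. t < r \<and> ennreal u < F r x) \<longleftrightarrow> ennreal u < (SUP n. F (q n) x)" for u
      proof
        assume "\<exists>r\<in>\<rat>. t < r \<and> ennreal u < F r x"
        then obtain r where r: "r \<in> \<rat>" "t < r" "ennreal u < F r x" by auto
        with q(3) obtain n where "q n < r" by auto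
        with elim r q_Rats have "F r x \<le> F (q n) x" by auto
        with r show "ennreal u < (SUP n. F (q n) x)"
          unfolding less_SUP_iff by (auto intro: less_le_trans)
      next
        assume "ennreal u < (SUP n. F (q n) x)"
        then show "\<exists>r\<in>\<rat>. t < r \<and> ennreal u < F r x"
          unfolding less_SUP_iff using q q_Rats by auto
      qed
      then have "emeasure (K x) {t<..} = emeasure unit_lborel {u \<in> space unit_lborel. ennreal u < (SUP n. F (q n) x)}"
        unfolding K_emeasure Q_gt using False by simp
      also have "\<dots> = (SUP n. F (q n) x)"
        using elim q_Rats by (intro emeasure_unit_lborel_less SUP_least) auto
      finally show ?case by (simp add: SUP_mult_right_ennreal)
    qed
    also have "\<dots> = (SUP n. \<integral>\<^sup>+x. F (q n) x * indicator A x \<partial>\<mu>)"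
    proof (rule nn_integral_monotone_convergence_SUP_AE)
      show "AE x in \<mu>. F (q n) x * indicator A x \<le> F (q (Suc n)) x * indicator A x" for n
        using AE by eventually_elim (use q q_Rats in \<open>auto intro!: mult_right_mono simp: decseq_SucD\<close>)
    qed (intro borel_measurable_times_ennreal Fm borel_measurable_indicator, simp add: s\<mu>)
    also have "\<dots> = (SUP n. emeasure \<pi> ((A \<times> UNIV) \<inter> S (q n)))"
      by (simp add: FA)
    also have "\<dots> = emeasure \<pi> (\<Union>n. (A \<times> UNIV) \<inter> S (q n))"
    proof (rule SUP_emeasure_incseq)
      show "incseq (\<lambda>n. (A \<times> UNIV) \<inter> S (q n))"
        using q(1) by (auto simp: S_def monotone_def intro: le_less_trans)
    qed auto
    also have "(\<Union>n. (A \<times> UNIV) \<inter> S (q n)) = (A \<times> UNIV) \<inter> S t"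
      using q(3) by (auto simp: S_def set_eq_iff)
    finally show ?thesis .
  qed
  \<comment> \<open>With \<open>A\<close> fixed, both sides are finite measures in \<open>B\<close>,
    so agreement on half-lines extends to all Borel sets.\<close>
  have joint: "(\<integral>\<^sup>+x\<in>A. emeasure (K x) B \<partial>\<mu>) = emeasure \<pi> ((A \<times> UNIV) \<inter> (\<lambda>z. arctan (snd z)) -` B)"
    if A[measurable]: "A \<in> sets borel" and B[measurable]: "B \<in> sets borel" for A B
  proof -
    let ?M = "distr (density \<pi> (indicator (A \<times> UNIV))) borel (\<lambda>z. arctan (snd z))"
    let ?N = "density \<mu> (indicator A) \<bind> K"
    have M: "emeasure ?M B = emeasure \<pi> ((A \<times> UNIV) \<inter> (\<lambda>z. arctan (snd z)) -` B)"
      if [measurable]: "B \<in> sets borel" for B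
    proof -
      have p: "(\<lambda>z. arctan (snd z)) -` B \<in> sets \<pi>"
        using measurable_sets[of "\<lambda>z. arctan (snd z)" \<pi> borel B] sp by simp
      have "emeasure ?M B = emeasure (density \<pi> (indicator (A \<times> UNIV))) ((\<lambda>z. arctan (snd z)) -` B)"
        using sp by (subst emeasure_distr) auto
      also have "\<dots> = emeasure \<pi> ((A \<times> UNIV) \<inter> (\<lambda>z. arctan (snd z)) -` B)"
        using p by (intro emeasure_restricted) auto
      finally show ?thesis .
    qed
    have N: "emeasure ?N B = (\<integral>\<^sup>+x\<in>A. emeasure (K x) B \<partial>\<mu>)" if [measurable]: "B \<in> sets borel" for B
    proof -
      have "emeasure ?N B = (\<integral>\<^sup>+x. emeasure (K x) B \<partial>density \<mu> (indicator A))"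
        by (rule emeasure_bind[where N = borel]) (auto simp: \<mu>_def)
      also have "\<dots> = (\<integral>\<^sup>+x\<in>A. emeasure (K x) B \<partial>\<mu>)"
        by (subst nn_integral_density) (simp_all add: measurable_cong_sets[OF s\<mu> refl] mult.commute)
      finally show ?thesis .
    qed
    have "?M = ?N"
    proof (rule measure_eqI_lessThan)
      show "sets ?N = sets borel"
        by (rule sets_bind) (auto simp: K_def \<mu>_def)
      show "emeasure ?M {t<..} < \<infinity>" for t
        by (simp add: M \<pi>.emeasure_eq_measure)
      show "emeasure ?M {t<..} = emeasure ?N {t<..}" for t
        using cut[OF A, of t] by (simp add: M N S_def vimage_def)
    qed simp
    then show ?thesis using M[OF B] N[OF B] by simp
  qed
  \<comment> \<open>As \<open>sin / cos\<close>, with division by zero giving 0, \<open>tan\<close>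
    is total and Borel; it inverts \<open>arctan\<close> exactly.\<close>
  have tan[measurable]: "tan \<in> borel_measurable (borel :: real measure)"
    unfolding tan_def[abs_def] by measurable
  show ?thesis
  proof (intro exI[of _ "\<lambda>x. distr (K x) borel tan"], unfold is_disintegration_def, intro conjI ballI)
    have sK[simp]: "sets (K x) = sets borel" "space (K x) = UNIV" for x
      by (simp_all add: K_def)
    have tK: "tan \<in> K x \<rightarrow>\<^sub>M borel" for x
      using tan by (simp add: measurable_cong_sets[OF sK(1) refl])
    show "(\<lambda>x. distr (K x) borel tan) \<in> borel \<rightarrow>\<^sub>M prob_algebra borel"
      by (intro measurable_prob_algebraI prob_space.prob_space_distr K_prob tK
            measurable_distr2[where M = borel] K) measurable
    fix A B :: "real set" assume [measurable]: "A \<in> sets borel" "B \<in> sets borel"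
    have B: "tan -` B \<in> sets borel"
      using measurable_sets[OF tan, of B] by simp
    have "(\<integral>\<^sup>+x\<in>A. emeasure (distr (K x) borel tan) B \<partial>\<mu>) = (\<integral>\<^sup>+x\<in>A. emeasure (K x) (tan -` B) \<partial>\<mu>)"
      using tK by (intro nn_integral_cong) (simp add: emeasure_distr)
    also have "\<dots> = emeasure \<pi> ((A \<times> UNIV) \<inter> (\<lambda>z. arctan (snd z)) -` (tan -` B))"
      using B by (intro joint) auto
    also have "(A \<times> UNIV) \<inter> (\<lambda>z. arctan (snd z)) -` (tan -` B) = A \<times> B"
      by (auto simp: tan_arctan)
    finally show "emeasure \<pi> (A \<times> B) =
        (\<integral>\<^sup>+x\<in>A. emeasure (distr (K x) borel tan) B \<partial>distr \<pi> borel fst)"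
      by (simp add: \<mu>_def)
  qed
qed

lemma is_disintegration_disint:
  assumes "prob_space \<pi>" "sets \<pi> = sets borel"
  shows "is_disintegration \<pi> (disint \<pi>)"
  unfolding disint_def by (rule someI_ex[OF is_disintegration_exists[OF assms]])

section \<open>Measurability and integration against kernels\<close>

lemma borel_measurable_kernel_nn_integral:
  fixes f :: "real \<times> real \<Rightarrow> ennreal"
  assumes f: "f \<in> borel_measurable borel" and \<kappa>: "\<kappa> \<in> borel \<rightarrow>\<^sub>M prob_algebra borel"
  shows "(\<lambda>x. \<integral>\<^sup>+y. f (x, y) \<partial>\<kappa> x) \<in> borel_measurable borel"
proof (rule nn_integral_measurable_subprob_algebra2[OF _ measurable_prob_algebraD[OF \<kappa>]])
  show "(\<lambda>(x, y). f (x, y)) \<in> borel_measurable (borel \<Otimes>\<^sub>M borel)"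
    unfolding borel_prod using f by simp
qed

lemma borel_measurable_kernel_integral:
  fixes f :: "real \<times> real \<Rightarrow> real"
  assumes f[measurable]: "f \<in> borel_measurable borel"
    and \<kappa>[measurable]: "\<kappa> \<in> borel \<rightarrow>\<^sub>M prob_algebra borel"
  shows "(\<lambda>x. \<integral>y. f (x, y) \<partial>\<kappa> x) \<in> borel_measurable borel"
proof -
  have s: "sets (\<kappa> x) = sets borel" for x
    using \<kappa>[THEN measurable_space, of x] by (auto simp: space_prob_algebra)
  \<comment> \<open>Moving \<open>\<kappa> x\<close> onto the vertical line over \<open>x\<close>
    makes the integrand a fixed function on the plane; \<open>x\<close> then enters through the
    measure alone.\<close>
  have "(\<lambda>x. distr (\<kappa> x) borel (Pair x)) \<in> borel \<rightarrow>\<^sub>M subprob_algebra (borel :: (real \<times> real) measure)"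
  proof (rule measurable_distr2)
    show "case_prod Pair \<in> borel \<Otimes>\<^sub>M borel \<rightarrow>\<^sub>M (borel :: (real \<times> real) measure)"
      unfolding borel_prod[symmetric] by measurable
    show "\<kappa> \<in> borel \<rightarrow>\<^sub>M subprob_algebra borel" by (rule measurable_prob_algebraD[OF \<kappa>])
  qed
  then have "(\<lambda>x. \<integral>z. f z \<partial>distr (\<kappa> x) borel (Pair x)) \<in> borel_measurable borel"
    by (rule measurable_compose[OF _ integral_measurable_subprob_algebra[OF f]])
  moreover have "(\<integral>z. f z \<partial>distr (\<kappa> x) borel (Pair x)) = (\<integral>y. f (x, y) \<partial>\<kappa> x)" for x
    by (rule integral_distr[OF _ f]) (simp add: measurable_cong_sets[OF s refl])
  ultimately show ?thesis by simp
qed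

text \<open>The positive and the negative part are treated separately by the identity for
  nonnegative functions. Off a null set both fibre integrals are finite, and the Bochner integral is
  their difference.\<close>

lemma
  fixes f :: "real \<times> real \<Rightarrow> real"
  assumes d: "is_disintegration \<pi> \<kappa>" and \<pi>: "prob_space \<pi>" "sets \<pi> = sets borel"
    and f: "integrable \<pi> f"
  shows AE_integrable_is_disintegration:
      "AE x in distr \<pi> borel fst. integrable (\<kappa> x) (\<lambda>y. f (x, y))" (is ?AE)
    and integrable_is_disintegration:
      "integrable (distr \<pi> borel fst) (\<lambda>x. \<integral>y. f (x, y) \<partial>\<kappa> x)" (is ?I)
    and integral_is_disintegration:
      "(\<integral>x. \<integral>y. f (x, y) \<partial>\<kappa> x \<partial>distr \<pi> borel fst) = (\<integral>z. f z \<partial>\<pi>)" (is ?E)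
proof -
  let ?\<mu> = "distr \<pi> borel fst"
  note k = is_disintegrationD[OF d]
  have fm[measurable]: "f \<in> borel_measurable borel"
    using borel_measurable_integrable[OF f] by (simp add: measurable_cong_sets[OF \<pi>(2) refl])
  have fx: "(\<lambda>y. f (x, y)) \<in> borel_measurable (\<kappa> x)" for x
    by (simp add: measurable_cong_sets[OF k(4) refl])
  let ?p = "\<lambda>x. \<integral>\<^sup>+y. ennreal (f (x, y)) \<partial>\<kappa> x" and ?n = "\<lambda>x. \<integral>\<^sup>+y. ennreal (- f (x, y)) \<partial>\<kappa> x"
  have pm: "?p \<in> borel_measurable borel" and nm: "?n \<in> borel_measurable borel"
    by (rule borel_measurable_kernel_nn_integral[OF _ k(1)], measurable)+
  have P: "(\<integral>\<^sup>+x. ?p x \<partial>?\<mu>) = (\<integral>\<^sup>+z. ennreal (f z) \<partial>\<pi>)"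
    and N: "(\<integral>\<^sup>+x. ?n x \<partial>?\<mu>) = (\<integral>\<^sup>+z. ennreal (- f z) \<partial>\<pi>)"
    by (rule nn_integral_is_disintegration[OF d \<pi>, symmetric], measurable)+
  have fin: "(\<integral>\<^sup>+z. ennreal (f z) \<partial>\<pi>) \<noteq> \<infinity>" "(\<integral>\<^sup>+z. ennreal (- f z) \<partial>\<pi>) \<noteq> \<infinity>"
    using f by (auto simp: real_integrable_def)
  have p_fin: "AE x in ?\<mu>. ?p x \<noteq> \<infinity>" and n_fin: "AE x in ?\<mu>. ?n x \<noteq> \<infinity>"
    using fin P N pm nm by (intro nn_integral_PInf_AE; simp)+
  show ?AE
    using p_fin n_fin by eventually_elim (use fx in \<open>auto simp: real_integrable_def\<close>)
  \<comment> \<open>This holds only almost everywhere: on a fibre without integrability the left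
    side is 0 by default, whereas the right side may be nonzero.\<close>
  have eq: "AE x in ?\<mu>. (\<integral>y. f (x, y) \<partial>\<kappa> x) = enn2real (?p x) - enn2real (?n x)"
    using \<open>?AE\<close> by eventually_elim (rule real_lebesgue_integral_def)
  have e: "(\<integral>\<^sup>+x. ennreal (enn2real (h x)) \<partial>?\<mu>) = (\<integral>\<^sup>+x. h x \<partial>?\<mu>)"
    if "AE x in ?\<mu>. h x \<noteq> \<infinity>" for h
    using that by (intro nn_integral_cong_AE) (auto simp: less_top)
  have ip: "integrable ?\<mu> (\<lambda>x. enn2real (?p x))" and in': "integrable ?\<mu> (\<lambda>x. enn2real (?n x))"
    using pm nm e[OF p_fin] e[OF n_fin] P N fin
    by (auto intro!: integrableI_nonneg simp: less_top)
  have "integrable ?\<mu> (\<lambda>x. enn2real (?p x) - enn2real (?n x))"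
    by (rule Bochner_Integration.integrable_diff[OF ip in'])
  then show ?I
    by (rule integrable_cong_AE_imp) (use eq borel_measurable_kernel_integral[OF fm k(1)] in auto)
  have "(\<integral>x. \<integral>y. f (x, y) \<partial>\<kappa> x \<partial>?\<mu>) = (\<integral>x. enn2real (?p x) - enn2real (?n x) \<partial>?\<mu>)"
    using eq borel_measurable_kernel_integral[OF fm k(1)] pm nm by (intro integral_cong_AE) auto
  also have "\<dots> = (\<integral>x. enn2real (?p x) \<partial>?\<mu>) - (\<integral>x. enn2real (?n x) \<partial>?\<mu>)"
    by (rule Bochner_Integration.integral_diff[OF ip in'])
  also have "\<dots> = enn2real (\<integral>\<^sup>+z. ennreal (f z) \<partial>\<pi>) - enn2real (\<integral>\<^sup>+z. ennreal (- f z) \<partial>\<pi>)"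
    using pm nm e[OF p_fin] e[OF n_fin] P N by (simp add: integral_eq_nn_integral)
  also have "\<dots> = (\<integral>z. f z \<partial>\<pi>)"
    by (rule real_lebesgue_integral_def[OF f, symmetric])
  finally show ?E .
qed

text \<open>The measure 0 of the exceptional set is the integral of its fibre masses, so almost all
  of these vanish.\<close>

lemma AE_is_disintegration:
  assumes d: "is_disintegration \<pi> \<kappa>" and \<pi>: "prob_space \<pi>" "sets \<pi> = sets borel"
    and S: "{z. S z} \<in> sets borel" and ae: "AE z in \<pi>. S z"
  shows "AE x in distr \<pi> borel fst. AE y in \<kappa> x. S (x, y)"
proof -
  let ?\<mu> = "distr \<pi> borel fst"
  note k = is_disintegrationD[OF d]
  let ?N = "{z. \<not> S z}"
  have "?N = - {z. S z}" by auto
  with S have N[measurable]: "?N \<in> sets borel" by simp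
  have Nx: "{y. \<not> S (x, y)} \<in> sets borel" for x
    using sets_Pair1[OF N[unfolded borel_prod[symmetric]], of x] by (simp add: vimage_def)
  have "(\<lambda>x. \<integral>\<^sup>+y. indicator ?N (x, y) \<partial>\<kappa> x) \<in> borel_measurable borel"
    by (rule borel_measurable_kernel_nn_integral[OF _ k(1)]) simp
  then have m: "(\<lambda>x. \<integral>\<^sup>+y. indicator ?N (x, y) \<partial>\<kappa> x) \<in> borel_measurable ?\<mu>"
    by simp
  have "(\<integral>\<^sup>+x. \<integral>\<^sup>+y. indicator ?N (x, y) \<partial>\<kappa> x \<partial>?\<mu>) = (\<integral>\<^sup>+z. indicator ?N z \<partial>\<pi>)"
    by (rule nn_integral_is_disintegration[OF d \<pi>, symmetric]) simp
  also have "\<dots> = (\<integral>\<^sup>+z. 0 \<partial>\<pi>)"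
    using ae by (intro nn_integral_cong_AE) (auto elim!: eventually_mono)
  finally have "AE x in ?\<mu>. (\<integral>\<^sup>+y. indicator ?N (x, y) \<partial>\<kappa> x) = 0"
    using nn_integral_0_iff_AE[OF m] by simp
  then show ?thesis
  proof eventually_elim
    case (elim x)
    have "(\<integral>\<^sup>+y. indicator ?N (x, y) \<partial>\<kappa> x) = (\<integral>\<^sup>+y. indicator {y. \<not> S (x, y)} y \<partial>\<kappa> x)"
      by (intro nn_integral_cong) (simp add: indicator_def)
    with elim have "emeasure (\<kappa> x) {y. \<not> S (x, y)} = 0"
      using Nx[of x] k(4)[of x] by simp
    then show ?case
      using Nx[of x] k(4,5)[of x] by (intro AE_I'[of "{y. \<not> S (x, y)}"]) auto
  qed
qed

text \<open>The converse of disintegration, which turns the corrected kernel into a measure on the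
  plane. The second marginal appears as a mixture of the kernels, the form in which the exchange
  preserves it.\<close>

lemma disintegrated_measure_exists:
  fixes \<mu> :: "real measure"
  assumes \<mu>: "prob_space \<mu>" "sets \<mu> = sets borel" and \<kappa>[measurable]: "\<kappa> \<in> borel \<rightarrow>\<^sub>M prob_algebra borel"
  shows "\<exists>\<pi>. prob_space \<pi> \<and> sets \<pi> = sets borel \<and> distr \<pi> borel fst = \<mu> \<and> is_disintegration \<pi> \<kappa> \<and>
    (\<forall>B\<in>sets borel. emeasure (distr \<pi> borel snd) B = (\<integral>\<^sup>+x. emeasure (\<kappa> x) B \<partial>\<mu>))"
proof -
  have k: "prob_space (\<kappa> x)" "sets (\<kappa> x) = sets borel" "space (\<kappa> x) = UNIV" for x
    using \<kappa>[THEN measurable_space, of x] sets_eq_imp_space_eq[of "\<kappa> x" borel]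
    by (auto simp: space_prob_algebra)
  let ?K = "\<lambda>x. distr (\<kappa> x) (borel \<Otimes>\<^sub>M borel) (Pair x)"
  have K: "?K \<in> borel \<rightarrow>\<^sub>M prob_algebra (borel \<Otimes>\<^sub>M borel)" by measurable
  have \<mu>K: "\<mu> \<in> space (prob_algebra borel)" using \<mu> by (simp add: space_prob_algebra)
  define \<pi> where "\<pi> = \<mu> \<bind> ?K"
  have "sets \<pi> = sets (borel \<Otimes>\<^sub>M borel)" unfolding \<pi>_def by (rule sets_bind'[OF \<mu>K K])
  also have "\<dots> = sets borel" unfolding borel_prod ..
  finally have \<pi>: "prob_space \<pi>" "sets \<pi> = sets borel"
    using prob_space_bind'[OF \<mu>K K] unfolding \<pi>_def by blast+
  have rect: "emeasure \<pi> (A \<times> B) = (\<integral>\<^sup>+x\<in>A. emeasure (\<kappa> x) B \<partial>\<mu>)"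
    if [measurable]: "A \<in> sets borel" "B \<in> sets borel" for A B
  proof -
    have "emeasure \<pi> (A \<times> B) = (\<integral>\<^sup>+x. emeasure (?K x) (A \<times> B) \<partial>\<mu>)"
      unfolding \<pi>_def by (rule emeasure_bind_prob_algebra[OF \<mu>K K]) simp
    also have "\<dots> = (\<integral>\<^sup>+x\<in>A. emeasure (\<kappa> x) B \<partial>\<mu>)"
    proof (rule nn_integral_cong)
      fix x
      have p: "Pair x \<in> \<kappa> x \<rightarrow>\<^sub>M borel \<Otimes>\<^sub>M borel"
        by (simp add: measurable_cong_sets[OF k(2) refl])
      have "emeasure (?K x) (A \<times> B) = emeasure (\<kappa> x) (Pair x -` (A \<times> B) \<inter> space (\<kappa> x))"
        by (rule emeasure_distr[OF p]) simp
      also have "Pair x -` (A \<times> B) \<inter> space (\<kappa> x) = (if x \<in> A then B else {})"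
        by (auto simp: k)
      finally show "emeasure (?K x) (A \<times> B) = emeasure (\<kappa> x) B * indicator A x" by simp
    qed
    finally show ?thesis .
  qed
  have sp: "space \<pi> = UNIV" using \<pi>(2) by (simp add: sets_eq_imp_space_eq)
  have m: "fst \<in> \<pi> \<rightarrow>\<^sub>M borel" "snd \<in> \<pi> \<rightarrow>\<^sub>M borel"
    by (simp_all add: measurable_cong_sets[OF \<pi>(2) refl])
  have one: "emeasure (\<kappa> x) UNIV = 1" for x
    using prob_space.emeasure_space_1[OF k(1), of x] by (simp add: k)
  have fst: "distr \<pi> borel fst = \<mu>"
  proof (rule measure_eqI)
    fix A assume "A \<in> sets (distr \<pi> borel fst)"
    then have A: "A \<in> sets borel" by simp
    have "emeasure (distr \<pi> borel fst) A = emeasure \<pi> (fst -` A \<inter> space \<pi>)"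
      by (rule emeasure_distr[OF m(1) A])
    also have "fst -` A \<inter> space \<pi> = A \<times> UNIV" unfolding sp by auto
    also have "emeasure \<pi> (A \<times> UNIV) = emeasure \<mu> A"
      using rect[OF A, of UNIV] A \<mu>(2) one by simp
    finally show "emeasure (distr \<pi> borel fst) A = emeasure \<mu> A" .
  qed (simp add: \<mu>)
  have snd: "emeasure (distr \<pi> borel snd) B = (\<integral>\<^sup>+x. emeasure (\<kappa> x) B \<partial>\<mu>)" if B: "B \<in> sets borel" for B
  proof -
    have "emeasure (distr \<pi> borel snd) B = emeasure \<pi> (snd -` B \<inter> space \<pi>)"
      by (rule emeasure_distr[OF m(2) B])
    also have "snd -` B \<inter> space \<pi> = UNIV \<times> B" unfolding sp by auto
    also have "emeasure \<pi> (UNIV \<times> B) = (\<integral>\<^sup>+x. emeasure (\<kappa> x) B \<partial>\<mu>)"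
      using rect[OF _ B, of UNIV] by simp
    finally show ?thesis .
  qed
  have "is_disintegration \<pi> \<kappa>"
    unfolding is_disintegration_def fst using \<kappa> rect by blast
  with \<pi> fst snd show ?thesis by blast
qed

subsection \<open>The lower bound\<close>

lemma coupling_marginals_mean:
  fixes p q :: "real measure"
  assumes f: "fst \<in> \<gamma> \<rightarrow>\<^sub>M borel" "snd \<in> \<gamma> \<rightarrow>\<^sub>M borel"
    and d: "distr \<gamma> borel fst = p" "distr \<gamma> borel snd = q"
    and i: "integrable p (\<lambda>x. x)" "integrable q (\<lambda>x. x)"
  shows "integrable \<gamma> fst" "integrable \<gamma> snd" "(\<integral>z. fst z \<partial>\<gamma>) = (\<integral>x. x \<partial>p)" "(\<integral>z. snd z \<partial>\<gamma>) = (\<integral>x. x \<partial>q)"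
proof -
  show "integrable \<gamma> fst"
    using i(1) unfolding d(1)[symmetric] by (rule integrable_distr[OF f(1), of "\<lambda>x. x"])
  show "integrable \<gamma> snd"
    using i(2) unfolding d(2)[symmetric] by (rule integrable_distr[OF f(2), of "\<lambda>x. x"])
  show "(\<integral>z. fst z \<partial>\<gamma>) = (\<integral>x. x \<partial>p)"
    unfolding d(1)[symmetric] by (rule integral_distr[OF f(1), of "\<lambda>x. x", symmetric]) simp
  show "(\<integral>z. snd z \<partial>\<gamma>) = (\<integral>x. x \<partial>q)"
    unfolding d(2)[symmetric] by (rule integral_distr[OF f(2), of "\<lambda>x. x", symmetric]) simp
qed

text \<open>Under any coupling the difference of the means is the expectation of the difference of
  the coordinates, whose modulus is at most the transport cost.\<close>

lemma abs_mean_diff_le_wasserstein1: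
  assumes p: "integrable p (\<lambda>x. x)" and q: "integrable q (\<lambda>x. x)"
  shows "ennreal \<bar>(\<integral>x. x \<partial>p) - (\<integral>x. x \<partial>q)\<bar> \<le> wasserstein1 p q"
  unfolding wasserstein1_def
proof (rule INF_greatest)
  fix \<gamma> assume "\<gamma> \<in> couplings p q"
  then have \<gamma>: "sets \<gamma> = sets borel" "distr \<gamma> borel fst = p" "distr \<gamma> borel snd = q"
    by (auto simp: couplings_def)
  have [measurable]: "fst \<in> \<gamma> \<rightarrow>\<^sub>M borel" "snd \<in> \<gamma> \<rightarrow>\<^sub>M borel"
    by (simp_all add: measurable_cong_sets[OF \<gamma>(1) refl])
  note m = coupling_marginals_mean[OF this \<gamma>(2,3) p q]
  have "(\<integral>x. x \<partial>p) - (\<integral>x. x \<partial>q) = (\<integral>z. fst z \<partial>\<gamma>) - (\<integral>z. snd z \<partial>\<gamma>)"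
    by (simp add: m)
  also have "\<dots> = (\<integral>z. fst z - snd z \<partial>\<gamma>)"
    by (rule Bochner_Integration.integral_diff[OF m(1,2), symmetric])
  finally have "ennreal \<bar>(\<integral>x. x \<partial>p) - (\<integral>x. x \<partial>q)\<bar> = ennreal (norm (\<integral>z. fst z - snd z \<partial>\<gamma>))"
    by simp
  also have "\<dots> \<le> (\<integral>\<^sup>+z. norm (fst z - snd z) \<partial>\<gamma>)"
    by (intro integral_norm_bound_ennreal Bochner_Integration.integrable_diff m(1,2))
  finally show "ennreal \<bar>(\<integral>x. x \<partial>p) - (\<integral>x. x \<partial>q)\<bar> \<le> (\<integral>\<^sup>+(x, y). ennreal \<bar>x - y\<bar> \<partial>\<gamma>)"
    by (simp add: case_prod_unfold)
qed

section \<open>First moments and convex order\<close>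

lemma P1D:
  assumes "\<mu> \<in> P1"
  shows "prob_space \<mu>" "sets \<mu> = sets borel" "integrable \<mu> (\<lambda>x. x)"
proof -
  show s: "sets \<mu> = sets borel" "prob_space \<mu>"
    using assms by (simp_all add: P1_def)
  have "(\<lambda>x. x) \<in> borel_measurable \<mu>"
    by (simp add: measurable_cong_sets[OF s(1) refl])
  then show "integrable \<mu> (\<lambda>x. x)"
    using assms by (intro integrable_abs_cancel[of \<mu> "\<lambda>x. x"]) (simp_all add: P1_def)
qed

lemma couplingsD:
  assumes "\<pi> \<in> couplings \<mu> \<nu>"
  shows "prob_space \<pi>" "sets \<pi> = sets borel" "distr \<pi> borel fst = \<mu>" "distr \<pi> borel snd = \<nu>"
    "fst \<in> \<pi> \<rightarrow>\<^sub>M borel" "snd \<in> \<pi> \<rightarrow>\<^sub>M borel"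
proof -
  show s: "prob_space \<pi>" "sets \<pi> = sets borel" "distr \<pi> borel fst = \<mu>" "distr \<pi> borel snd = \<nu>"
    using assms by (simp_all add: couplings_def)
  show "fst \<in> \<pi> \<rightarrow>\<^sub>M borel" "snd \<in> \<pi> \<rightarrow>\<^sub>M borel"
    by (simp_all add: measurable_cong_sets[OF s(2) refl])
qed

lemma integrable_increment:
  assumes "\<mu> \<in> P1" "\<nu> \<in> P1" and c: "\<pi> \<in> couplings \<mu> \<nu>"
  shows "integrable \<pi> (\<lambda>z. snd z - fst z)"
    "(\<integral>z. snd z - fst z \<partial>\<pi>) = (\<integral>x. x \<partial>\<nu>) - (\<integral>x. x \<partial>\<mu>)"
proof -
  note \<pi> = couplingsD[OF c]
  note m = coupling_marginals_mean[OF \<pi>(5,6,3,4) P1D(3)[OF assms(1)] P1D(3)[OF assms(2)]]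
  show "integrable \<pi> (\<lambda>z. snd z - fst z)"
    by (intro Bochner_Integration.integrable_diff m(1,2))
  show "(\<integral>z. snd z - fst z \<partial>\<pi>) = (\<integral>x. x \<partial>\<nu>) - (\<integral>x. x \<partial>\<mu>)"
    using Bochner_Integration.integral_diff[OF m(2,1)] m(3,4) by simp
qed

text \<open>Both parts are finite, so the subtraction of extended reals is ordinary
  subtraction.\<close>

lemma ext_integral_eq_integral:
  assumes "integrable M f"
  shows "ext_integral M f = ereal (\<integral>x. f x \<partial>M)"
proof -
  have "(\<integral>\<^sup>+x. ennreal (f x) \<partial>M) \<noteq> \<infinity>" "(\<integral>\<^sup>+x. ennreal (- f x) \<partial>M) \<noteq> \<infinity>"
    using assms by (auto simp: real_integrable_def)
  then show ?thesis
    unfolding ext_integral_def real_lebesgue_integral_def[OF assms]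
    by (cases "\<integral>\<^sup>+x. ennreal (f x) \<partial>M" rule: ennreal_cases;
        cases "\<integral>\<^sup>+x. ennreal (- f x) \<partial>M" rule: ennreal_cases) auto
qed

text \<open>The identity and its negative are both convex, which gives the two inequalities.\<close>

lemma convex_order_mean_eq:
  assumes "\<mu> \<in> P1" "\<nu> \<in> P1" "convex_order \<mu> \<nu>"
  shows "(\<integral>x. x \<partial>\<mu>) = (\<integral>x. x \<partial>\<nu>)"
proof -
  note i = P1D(3)[OF assms(1)] P1D(3)[OF assms(2)]
  have "convex_on UNIV (\<lambda>x::real. x)" "convex_on UNIV (\<lambda>x::real. - x)"
    by (simp_all add: convex_on_def algebra_simps)
  then have "ext_integral \<mu> (\<lambda>x. x) \<le> ext_integral \<nu> (\<lambda>x. x)"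
    "ext_integral \<mu> (\<lambda>x. - x) \<le> ext_integral \<nu> (\<lambda>x. - x)"
    using assms(3) unfolding convex_order_def by blast+
  then show ?thesis
    using i by (simp add: ext_integral_eq_integral)
qed

text \<open>The kernel of \<open>\<pi>\<close> at \<open>x\<close> has mean \<open>x + g x\<close>,
  a martingale kernel at \<open>y\<close> has mean \<open>y\<close>. The transport cost between them
  is thus at least \<open>\<bar>g x + x - y\<bar>\<close>, and the triangle inequality leaves
  \<open>\<bar>g x\<bar>\<close>.\<close>

lemma barycentre_gap_le_nested_wasserstein1:
  assumes \<mu>: "\<mu> \<in> P1" and \<nu>: "\<nu> \<in> P1" and c: "\<pi> \<in> couplings \<mu> \<nu>" and m: "\<pi>' \<in> martingale_couplings \<mu> \<nu>"
  shows "barycentre_gap \<pi> \<le> nested_wasserstein1 \<pi> \<pi>'"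
  unfolding nested_wasserstein1_def
proof (rule INF_greatest)
  have c': "\<pi>' \<in> couplings \<mu> \<nu>"
    and mart: "AE y in \<mu>. has_bochner_integral (disint \<pi>' y) (\<lambda>z. z - y) 0"
    using m by (auto simp: martingale_couplings_def)
  note \<pi> = couplingsD[OF c] and \<pi>' = couplingsD[OF c']
  fix \<gamma> assume "\<gamma> \<in> couplings (distr \<pi> borel fst) (distr \<pi>' borel fst)"
  then have \<gamma>c: "\<gamma> \<in> couplings \<mu> \<mu>" by (simp add: \<pi>(3) \<pi>'(3))
  note \<gamma> = couplingsD[OF \<gamma>c]
  note [measurable] = \<gamma>(5,6)
  let ?\<kappa> = "disint \<pi>"
  note d = is_disintegration_disint[OF \<pi>(1,2)]
  note k = is_disintegrationD[OF d]
  define g where "g x = (\<integral>y. y - x \<partial>?\<kappa> x)" for x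
  have [measurable]: "g \<in> borel_measurable borel"
    unfolding g_def
    using borel_measurable_kernel_integral[OF _ k(1), of "\<lambda>z. snd z - fst z"] by simp
  have int: "AE x in \<mu>. integrable (?\<kappa> x) (\<lambda>y. y - x)"
    using AE_integrable_is_disintegration[OF d \<pi>(1,2) integrable_increment(1)[OF \<mu> \<nu> c]]
    unfolding \<pi>(3) by simp
  \<comment> \<open>Properties holding almost surely for \<open>\<mu>\<close> pass to
    \<open>\<gamma>\<close> through its two marginals, one for each disintegration.\<close>
  have 1: "AE z in \<gamma>. integrable (?\<kappa> (fst z)) (\<lambda>y. y - fst z)"
    using int unfolding \<gamma>(3)[symmetric] by (rule AE_distrD[rotated]) simp
  have 2: "AE z in \<gamma>. has_bochner_integral (disint \<pi>' (snd z)) (\<lambda>y. y - snd z) 0"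
    using mart unfolding \<gamma>(4)[symmetric] by (rule AE_distrD[rotated]) simp
  have W: "AE z in \<gamma>. ennreal \<bar>g (fst z) + fst z - snd z\<bar> \<le> wasserstein1 (?\<kappa> (fst z)) (disint \<pi>' (snd z))"
    using 1 2
  proof eventually_elim
    case (elim z)
    obtain x y where z: "z = (x, y)" by (cases z)
    interpret p: prob_space "?\<kappa> x" by (rule k(3))
    interpret q: prob_space "disint \<pi>' y"
      by (rule is_disintegrationD(3)[OF is_disintegration_disint[OF \<pi>'(1,2)]])
    have "integrable (?\<kappa> x) (\<lambda>y. (y - x) + x)"
      using elim z by (intro Bochner_Integration.integrable_add) auto
    then have p: "integrable (?\<kappa> x) (\<lambda>y. y)" by simp
    have iq: "integrable (disint \<pi>' y) (\<lambda>z. z - y)" "(\<integral>z. z - y \<partial>disint \<pi>' y) = 0"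
      using elim z by (auto simp: has_bochner_integral_iff)
    have "integrable (disint \<pi>' y) (\<lambda>z. (z - y) + y)"
      using iq by (intro Bochner_Integration.integrable_add) auto
    then have q: "integrable (disint \<pi>' y) (\<lambda>y. y)" by simp
    have "(\<integral>y. y \<partial>?\<kappa> x) = g x + x"
      using p unfolding g_def by (simp add: p.prob_space)
    moreover have "(\<integral>z. z \<partial>disint \<pi>' y) = y"
      using iq q by (simp add: q.prob_space)
    ultimately show ?case
      using abs_mean_diff_le_wasserstein1[OF p q] by (simp add: z)
  qed
  have "barycentre_gap \<pi> = (\<integral>\<^sup>+x. ennreal \<bar>g x\<bar> \<partial>distr \<gamma> borel fst)"
    unfolding barycentre_gap_def g_def \<gamma>(3) \<pi>(3) ..
  also have "\<dots> = (\<integral>\<^sup>+z. ennreal \<bar>g (fst z)\<bar> \<partial>\<gamma>)"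
    by (rule nn_integral_distr) auto
  also have "\<dots> \<le> (\<integral>\<^sup>+z. ennreal \<bar>fst z - snd z\<bar> + ennreal \<bar>g (fst z) + fst z - snd z\<bar> \<partial>\<gamma>)"
    by (intro nn_integral_mono) (simp flip: ennreal_plus)
  also have "\<dots> = (\<integral>\<^sup>+z. ennreal \<bar>fst z - snd z\<bar> \<partial>\<gamma>) + (\<integral>\<^sup>+z. ennreal \<bar>g (fst z) + fst z - snd z\<bar> \<partial>\<gamma>)"
    by (rule nn_integral_add) auto
  \<comment> \<open>\<open>wasserstein1\<close> enters only after the integral has been split:
    monotonicity asks for no measurability of the larger integrand, additivity would.\<close>
  also have "\<dots> \<le> (\<integral>\<^sup>+z. ennreal \<bar>fst z - snd z\<bar> \<partial>\<gamma>) +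
      (\<integral>\<^sup>+z. wasserstein1 (?\<kappa> (fst z)) (disint \<pi>' (snd z)) \<partial>\<gamma>)"
    by (intro add_left_mono nn_integral_mono_AE W)
  finally show "barycentre_gap \<pi> \<le> (\<integral>\<^sup>+(x, y). ennreal \<bar>x - y\<bar> \<partial>\<gamma>) +
      (\<integral>\<^sup>+(x, y). wasserstein1 (disint \<pi> x) (disint \<pi>' y) \<partial>\<gamma>)"
    by (simp add: case_prod_unfold)
qed

subsection \<open>Pairing the points with negative and positive drift\<close>

text \<open>The quantile coupling: one uniform variable is fed into both pseudo-inverse distribution
  functions.\<close>

lemma monotone_coupling_exists:
  assumes P: "real_distribution P" and Q: "real_distribution Q"
    and le: "\<And>x. cdf Q x \<le> cdf P x"
  shows "\<exists>\<gamma>\<in>couplings P Q. AE z in \<gamma>. fst z \<le> snd z"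
proof -
  interpret P: cdf_distribution P unfolding cdf_distribution_def by (rule P)
  interpret Q: cdf_distribution Q unfolding cdf_distribution_def by (rule Q)
  have m: "P.I \<in> unit_lborel \<rightarrow>\<^sub>M borel" "Q.I \<in> unit_lborel \<rightarrow>\<^sub>M borel"
    using P.measurable_CI Q.measurable_CI
    by (simp_all add: measurable_cong_sets[OF sets_restrict_space_cong[OF sets_lborel] refl])
  have m2: "(\<lambda>u. (P.I u, Q.I u)) \<in> unit_lborel \<rightarrow>\<^sub>M borel"
    unfolding borel_prod[symmetric] using m by (rule measurable_Pair)
  have I_le: "P.I u \<le> Q.I u" if "u \<in> space unit_lborel" for u
  proof -
    have u: "0 < u" "u < 1" using that by (auto simp: space_restrict_space)
    \<comment> \<open>The pseudo-inverse satisfies \<open>I u \<le> x\<close> iff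
      \<open>u \<le> cdf x\<close>. Used for \<open>Q\<close> and then for \<open>P\<close> at the
      point \<open>Q.I u\<close>, this reverses the order of the distribution functions.\<close>
    have "u \<le> cdf Q (Q.I u)" using Q.pseudoinverse[OF u, of "Q.I u"] by simp
    also have "\<dots> \<le> cdf P (Q.I u)" by (rule le)
    finally show ?thesis using P.pseudoinverse[OF u, of "Q.I u"] by simp
  qed
  let ?\<gamma> = "distr unit_lborel borel (\<lambda>u. (P.I u, Q.I u))"
  have "distr ?\<gamma> borel fst = P" "distr ?\<gamma> borel snd = Q"
    using P.distr_I_eq_M Q.distr_I_eq_M
    by (simp_all add: distr_distr[OF measurable_fst_borel m2] distr_distr[OF measurable_snd_borel m2] comp_def)
  then have "?\<gamma> \<in> couplings P Q"
    using prob_space.prob_space_distr[OF prob_space_unit_lborel m2] by (simp add: couplings_def)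
  moreover have "AE z in ?\<gamma>. fst z \<le> snd z"
  proof (subst AE_distr_iff[OF m2])
    have "{z. fst z \<le> snd z} \<in> sets (borel :: (real \<times> real) measure)" by measurable
    then show "{z \<in> space borel. fst z \<le> snd z} \<in> sets (borel :: (real \<times> real) measure)" by simp
  qed (use I_le in auto)
  ultimately show ?thesis by blast
qed

text \<open>Meant for the normalised negative and positive parts of the drift; the formula for
  \<open>cdf\<close> makes stochastic order comparable with the tail condition.\<close>

lemma real_distribution_density:
  assumes \<mu>: "prob_space \<mu>" "sets \<mu> = sets borel"
    and h: "integrable \<mu> h" "\<And>x. 0 \<le> h x" "(\<integral>x. h x \<partial>\<mu>) = 1"
  shows "real_distribution (density \<mu> (\<lambda>x. ennreal (h x)))"
    "cdf (density \<mu> (\<lambda>x. ennreal (h x))) t = (\<integral>x. indicator {..t} x * h x \<partial>\<mu>)"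
proof -
  let ?P = "density \<mu> (\<lambda>x. ennreal (h x))"
  have em: "emeasure ?P A = ennreal (\<integral>x. indicator A x * h x \<partial>\<mu>)" if "A \<in> sets borel" for A
  proof -
    have A: "A \<in> sets \<mu>" using that \<mu> by simp
    have "emeasure ?P A = (\<integral>\<^sup>+x. ennreal (h x) * indicator A x \<partial>\<mu>)"
      using h(1) by (intro emeasure_density A) simp
    also have "\<dots> = (\<integral>\<^sup>+x. ennreal (indicator A x * h x) \<partial>\<mu>)"
      by (intro nn_integral_cong) (simp add: indicator_def)
    also have "\<dots> = ennreal (\<integral>x. indicator A x * h x \<partial>\<mu>)"
      using A h by (intro nn_integral_eq_integral)
        (auto intro!: integrable_real_mult_indicator simp: mult.commute[of "indicator A _"])
    finally show ?thesis .
  qed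
  have "prob_space ?P"
    using em[of UNIV] h(3) sets_eq_imp_space_eq[OF \<mu>(2)] by (intro prob_spaceI) simp
  then show "real_distribution ?P"
    by (simp add: real_distribution_def real_distribution_axioms_def \<mu>(2))
  show "cdf ?P t = (\<integral>x. indicator {..t} x * h x \<partial>\<mu>)"
    unfolding cdf_def measure_def em[OF atMost_borel] using h(2) by simp
qed

text \<open>Dispersion concerns closed half-lines, but the complement of \<open>{..t}\<close> in a
  distribution function is open. The closed half-lines from \<open>x + 1/(n+1)\<close> increase to
  the open one, and dominated convergence passes to the limit.\<close>

lemma tail_integral_open_nonneg:
  fixes \<mu> :: "real measure" and g :: "real \<Rightarrow> real"
  assumes \<mu>: "sets \<mu> = sets borel" and g: "integrable \<mu> g"
    and tail: "\<And>x. 0 \<le> (\<integral>t. indicator {x..} t * g t \<partial>\<mu>)"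
  shows "0 \<le> (\<integral>t. indicator {x<..} t * g t \<partial>\<mu>)"
proof -
  let ?a = "\<lambda>n. x + inverse (real (Suc n))"
  have gm: "g \<in> borel_measurable \<mu>" using g by simp
  have "(\<lambda>n. \<integral>t. indicator {?a n..} t * g t \<partial>\<mu>) \<longlonglongrightarrow> (\<integral>t. indicator {x<..} t * g t \<partial>\<mu>)"
  proof (rule integral_dominated_convergence[where w = "\<lambda>t. \<bar>g t\<bar>"])
    show "AE t in \<mu>. (\<lambda>n. indicator {?a n..} t * g t) \<longlonglongrightarrow> indicator {x<..} t * g t"
    proof (rule AE_I2)
      fix t
      have "\<forall>\<^sub>F n in sequentially. indicator {?a n..} t * g t = indicator {x<..} t * g t"
      proof (cases "x < t")
        case True
        then obtain N where "inverse (real (Suc N)) < t - x"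
          using reals_Archimedean[of "t - x"] by auto
        then show ?thesis
        proof (intro eventually_sequentiallyI[of N])
          fix n assume "N \<le> n"
          then have "inverse (real (Suc n)) \<le> inverse (real (Suc N))"
            by (intro le_imp_inverse_le) auto
          with \<open>inverse (real (Suc N)) < t - x\<close> have "?a n \<le> t" by linarith
          with True show "indicator {?a n..} t * g t = indicator {x<..} t * g t" by simp
        qed
      next
        case False
        then have "\<not> ?a n \<le> t" for n
        proof -
          have "0 < inverse (real (Suc n))" by simp
          with False show ?thesis by linarith
        qed
        with False show ?thesis by simp
      qed
      then show "(\<lambda>n. indicator {?a n..} t * g t) \<longlonglongrightarrow> indicator {x<..} t * g t"
        by (rule tendsto_eventually)
    qed
    show "integrable \<mu> (\<lambda>t. \<bar>g t\<bar>)" using g by simp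
    show "AE t in \<mu>. norm (indicator {?a n..} t * g t) \<le> \<bar>g t\<bar>" for n
      by (intro AE_I2) (simp add: indicator_def)
  qed (use gm \<mu> in \<open>auto intro!: borel_measurable_times borel_measurable_indicator\<close>)
  then show ?thesis
    by (rule LIMSEQ_le_const) (use tail in auto)
qed

lemma couplings_swap:
  assumes "\<gamma> \<in> couplings \<mu> \<nu>"
  shows "distr \<gamma> borel prod.swap \<in> couplings \<nu> \<mu>"
proof -
  note \<gamma> = couplingsD[OF assms]
  have s: "prod.swap \<in> \<gamma> \<rightarrow>\<^sub>M borel"
    unfolding prod.swap_def borel_prod[symmetric] using \<gamma>(6,5) by (rule measurable_Pair)
  show ?thesis
    using \<gamma> prob_space.prob_space_distr[OF \<gamma>(1) s]
    by (simp add: couplings_def distr_distr[OF measurable_fst_borel s]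
          distr_distr[OF measurable_snd_borel s] comp_def)
qed

text \<open>
  \<open>\<bar>g\<bar> \<mu> \<otimes> \<rho>\<close> is twice the symmetrisation of a monotone coupling of the negative part of \<open>g \<mu>\<close>
  with its positive part; the tail condition says precisely that the former lies to the left of the
  latter.
\<close>

lemma symmetric_partner_kernel_exists:
  fixes \<mu> :: "real measure" and g :: "real \<Rightarrow> real"
  assumes \<mu>: "prob_space \<mu>" "sets \<mu> = sets borel"
    and g: "g \<in> borel_measurable borel" "integrable \<mu> g" "(\<integral>x. g x \<partial>\<mu>) = 0"
    and tail: "\<And>x. 0 \<le> (\<integral>t. indicator {x..} t * g t \<partial>\<mu>)"
  shows "\<exists>\<rho>. \<rho> \<in> borel \<rightarrow>\<^sub>M prob_algebra borel \<and>
    (\<forall>f \<in> borel_measurable borel. (\<integral>\<^sup>+x. ennreal \<bar>g x\<bar> * (\<integral>\<^sup>+b. f (x, b) \<partial>\<rho> x) \<partial>\<mu>) =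
        (\<integral>\<^sup>+x. ennreal \<bar>g x\<bar> * (\<integral>\<^sup>+b. f (b, x) \<partial>\<rho> x) \<partial>\<mu>)) \<and>
    (AE x in \<mu>. g x \<noteq> 0 \<longrightarrow> (AE b in \<rho> x. (g x < 0 \<and> 0 < g b \<and> x \<le> b) \<or> (0 < g x \<and> g b < 0 \<and> b \<le> x)))"
proof -
  interpret \<mu>: prob_space \<mu> by fact
  note [measurable] = g(1)
  have gm[measurable]: "g \<in> borel_measurable \<mu>"
    using g(2) by simp
  define n p where "n x = max 0 (- g x)" and "p x = max 0 (g x)" for x
  have np: "integrable \<mu> n" "integrable \<mu> p"
    unfolding n_def p_def using g(2) by auto
  have np0: "0 \<le> n x" "0 \<le> p x" for x by (simp_all add: n_def p_def)
  have pn: "p x - n x = g x" "p x + n x = \<bar>g x\<bar>" for x by (auto simp: n_def p_def)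
  \<comment> \<open>Since \<open>g\<close> has integral 0, its negative and positive parts share the
    mass \<open>c\<close>, which normalises both.\<close>
  define c where "c = (\<integral>x. n x \<partial>\<mu>)"
  have "(\<integral>x. p x - n x \<partial>\<mu>) = 0" using g(3) by (simp add: pn)
  then have c': "(\<integral>x. p x \<partial>\<mu>) = c" using np by (simp add: c_def)
  have c0: "0 \<le> c" unfolding c_def using np0 by (intro Bochner_Integration.integral_nonneg) auto
  show ?thesis
  proof (cases "c = 0")
    case True
    then have "AE x in \<mu>. n x = 0" "AE x in \<mu>. p x = 0"
      using integral_nonneg_eq_0_iff_AE[OF np(1)] integral_nonneg_eq_0_iff_AE[OF np(2)] c' np0
      by (simp_all add: c_def)
    then have g0: "AE x in \<mu>. g x = 0"
      by eventually_elim (simp add: pn(1)[symmetric])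
    show ?thesis
    \<comment> \<open>Here \<open>g\<close> vanishes almost everywhere and both conditions become
      void; point masses supply a measurable kernel.\<close>
    proof (intro exI[of _ "return borel"] conjI ballI)
      show "return borel \<in> borel \<rightarrow>\<^sub>M prob_algebra (borel :: real measure)"
        by (intro measurable_prob_algebraI prob_space_return return_measurable) simp
      show "AE x in \<mu>. g x \<noteq> 0 \<longrightarrow> (AE b in return borel x. (g x < 0 \<and> 0 < g b \<and> x \<le> b) \<or> (0 < g x \<and> g b < 0 \<and> b \<le> x))"
        using g0 by eventually_elim simp
      show "(\<integral>\<^sup>+x. ennreal \<bar>g x\<bar> * (\<integral>\<^sup>+b. f (x, b) \<partial>return borel x) \<partial>\<mu>) =
          (\<integral>\<^sup>+x. ennreal \<bar>g x\<bar> * (\<integral>\<^sup>+b. f (b, x) \<partial>return borel x) \<partial>\<mu>)" for f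
        using g0 by (intro nn_integral_cong_AE) (auto elim!: eventually_mono)
    qed
  next
    case False
    with c0 have c: "0 < c" by simp
    let ?P = "density \<mu> (\<lambda>x. ennreal (n x / c))" and ?Q = "density \<mu> (\<lambda>x. ennreal (p x / c))"
    have i: "integrable \<mu> (\<lambda>x. n x / c)" "integrable \<mu> (\<lambda>x. p x / c)"
      "(\<integral>x. n x / c \<partial>\<mu>) = 1" "(\<integral>x. p x / c \<partial>\<mu>) = 1" "\<And>x. 0 \<le> n x / c" "\<And>x. 0 \<le> p x / c"
      using np np0 c c' c_def by auto
    note P = real_distribution_density[OF \<mu> i(1,5,3)] and Q = real_distribution_density[OF \<mu> i(2,6,4)]
    have "cdf ?Q t \<le> cdf ?P t" for t
    proof -
      have ig: "integrable \<mu> (\<lambda>x. indicator A x * h x)" if "A \<in> sets borel" "integrable \<mu> h" for A and h :: "real \<Rightarrow> real"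
        using integrable_real_mult_indicator[of A \<mu> h] that \<mu>(2) by (simp add: mult.commute)
      \<comment> \<open>The difference is the integral of \<open>- g / c\<close> over
        \<open>{..t}\<close>. As \<open>g\<close> has total integral 0, this is the integral of
        \<open>g / c\<close> over the complement, nonnegative by the tail condition.\<close>
      have "cdf ?P t - cdf ?Q t = (\<integral>x. indicator {..t} x * (n x / c) - indicator {..t} x * (p x / c) \<partial>\<mu>)"
        unfolding P(2) Q(2) by (intro Bochner_Integration.integral_diff[symmetric] ig i) auto
      also have "\<dots> = (\<integral>x. (indicator {t<..} x * g x - g x) / c \<partial>\<mu>)"
        using c pn by (intro Bochner_Integration.integral_cong refl) (auto simp: indicator_def field_simps)
      also have "\<dots> = (\<integral>x. indicator {t<..} x * g x \<partial>\<mu>) / c"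
        using g(2,3) ig[of "{t<..}" g] by simp
      also have "\<dots> \<ge> 0"
        using tail_integral_open_nonneg[OF \<mu>(2) g(2) tail] c by simp
      finally show ?thesis by simp
    qed
    then obtain \<gamma> where \<gamma>c: "\<gamma> \<in> couplings ?P ?Q" and \<gamma>le: "AE z in \<gamma>. fst z \<le> snd z"
      using monotone_coupling_exists[OF P(1) Q(1)] by blast
    note \<gamma> = couplingsD[OF \<gamma>c]
    let ?\<gamma>' = "distr \<gamma> borel prod.swap"
    have sw: "prod.swap \<in> \<gamma> \<rightarrow>\<^sub>M borel"
      unfolding prod.swap_def borel_prod[symmetric] using \<gamma>(6,5) by (rule measurable_Pair)
    note \<gamma>' = couplingsD[OF couplings_swap[OF \<gamma>c]]
    let ?S = "\<lambda>z. g (fst z) < 0 \<and> 0 < g (snd z) \<and> fst z \<le> snd z"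
    have S[measurable]: "{z. ?S z} \<in> sets borel" "{z. ?S (prod.swap z)} \<in> sets borel"
      by (simp_all add: prod.swap_def)
    have "AE x in ?P. g x < 0"
      using c i(1) by (subst AE_density) (auto simp: n_def max_def zero_less_divide_iff)
    then have 1: "AE z in \<gamma>. g (fst z) < 0"
      unfolding \<gamma>(3)[symmetric] by (rule AE_distrD[OF \<gamma>(5)])
    have "AE x in ?Q. 0 < g x"
      using c i(2) by (subst AE_density) (auto simp: p_def max_def zero_less_divide_iff)
    then have 2: "AE z in \<gamma>. 0 < g (snd z)"
      unfolding \<gamma>(4)[symmetric] by (rule AE_distrD[OF \<gamma>(6)])
    have S\<gamma>: "AE z in \<gamma>. ?S z"
      using 1 2 \<gamma>le by eventually_elim auto
    have S\<gamma>': "AE z in ?\<gamma>'. ?S (prod.swap z)"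
      using S\<gamma> S(2) by (subst AE_distr_iff[OF sw]) simp_all
    note d1 = is_disintegration_disint[OF \<gamma>(1,2)] and d2 = is_disintegration_disint[OF \<gamma>'(1,2)]
    define \<rho>1 \<rho>2 where "\<rho>1 = disint \<gamma>" and "\<rho>2 = disint ?\<gamma>'"
    note d = d1[folded \<rho>1_def] d2[folded \<rho>2_def]
    have k1: "\<rho>1 \<in> borel \<rightarrow>\<^sub>M prob_algebra borel" and k2: "\<rho>2 \<in> borel \<rightarrow>\<^sub>M prob_algebra borel"
      using is_disintegrationD(1)[OF d(1)] is_disintegrationD(1)[OF d(2)] .
    \<comment> \<open>Points with negative \<open>g\<close> count as first coordinates of
      \<open>\<gamma>\<close> and draw a second one; all others count as second coordinates and draw
      a first one. Where \<open>g\<close> vanishes the choice has weight 0.\<close>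
    define \<rho> where "\<rho> x = (if g x < 0 then \<rho>1 x else \<rho>2 x)" for x
    have \<rho>: "\<rho> \<in> borel \<rightarrow>\<^sub>M prob_algebra borel"
      unfolding \<rho>_def using k1 k2 by measurable
    \<comment> \<open>A property almost sure under \<open>?P\<close> is almost sure under
      \<open>\<mu>\<close> only where the density is positive, hence the premise.\<close>
    have A1: "AE x in \<mu>. 0 < n x \<longrightarrow> (AE b in \<rho>1 x. ?S (x, b))"
      using AE_is_disintegration[OF d(1) \<gamma>(1,2) S(1) S\<gamma>] unfolding \<gamma>(3)
      using i(1) c by (subst (asm) AE_density) (auto elim!: eventually_mono)
    have A2: "AE x in \<mu>. 0 < p x \<longrightarrow> (AE b in \<rho>2 x. ?S (prod.swap (x, b)))"
      using AE_is_disintegration[OF d(2) \<gamma>'(1,2) S(2) S\<gamma>'] unfolding \<gamma>'(3)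
      using i(2) c by (subst (asm) AE_density) (auto elim!: eventually_mono)
    have supp: "AE x in \<mu>. g x \<noteq> 0 \<longrightarrow>
        (AE b in \<rho> x. (g x < 0 \<and> 0 < g b \<and> x \<le> b) \<or> (0 < g x \<and> g b < 0 \<and> b \<le> x))"
      using A1 A2
    proof eventually_elim
      case (elim x)
      show ?case
      proof (cases "g x < 0")
        case True
        then have "0 < n x" by (simp add: n_def)
        with elim have *: "AE b in \<rho>1 x. ?S (x, b)" by simp
        have eq: "\<rho> x = \<rho>1 x" using True by (simp add: \<rho>_def)
        from * show ?thesis unfolding eq using True by (auto elim!: eventually_mono)
      next
        case g: False
        show ?thesis
        proof
          assume "g x \<noteq> 0"
          with g have "0 < g x" by simp
          then have "0 < p x" by (simp add: p_def)
          with elim have *: "AE b in \<rho>2 x. ?S (prod.swap (x, b))" by simp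
          have eq: "\<rho> x = \<rho>2 x" using g by (simp add: \<rho>_def)
          from * show "AE b in \<rho> x. (g x < 0 \<and> 0 < g b \<and> x \<le> b) \<or> (0 < g x \<and> g b < 0 \<and> b \<le> x)"
            unfolding eq using \<open>0 < g x\<close> by (auto elim!: eventually_mono)
        qed
      qed
    qed
    \<comment> \<open>Because \<open>\<bar>g x\<bar> = n x + p x\<close>, the integral splits over
      the two laws. The result is unchanged when \<open>f\<close> is replaced by
      \<open>f \<circ> prod.swap\<close>, and this is the desired symmetry.\<close>
    have I: "(\<integral>\<^sup>+x. ennreal \<bar>g x\<bar> * (\<integral>\<^sup>+b. f (x, b) \<partial>\<rho> x) \<partial>\<mu>) =
        ennreal c * (\<integral>\<^sup>+z. f z \<partial>\<gamma>) + ennreal c * (\<integral>\<^sup>+z. f (prod.swap z) \<partial>\<gamma>)"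
      if f[measurable]: "f \<in> borel_measurable borel" for f
    proof -
      let ?F1 = "\<lambda>x. \<integral>\<^sup>+b. f (x, b) \<partial>\<rho>1 x" and ?F2 = "\<lambda>x. \<integral>\<^sup>+b. f (x, b) \<partial>\<rho>2 x"
      have F: "?F1 \<in> borel_measurable \<mu>" "?F2 \<in> borel_measurable \<mu>"
        using borel_measurable_kernel_nn_integral[OF f k1] borel_measurable_kernel_nn_integral[OF f k2]
        by (simp_all add: measurable_cong_sets[OF \<mu>(2) refl])
      have w: "(\<lambda>x. ennreal (n x / c)) \<in> borel_measurable \<mu>" "(\<lambda>x. ennreal (p x / c)) \<in> borel_measurable \<mu>"
        using i by auto
      have "ennreal \<bar>g x\<bar> * (\<integral>\<^sup>+b. f (x, b) \<partial>\<rho> x) =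
          ennreal c * (ennreal (n x / c) * ?F1 x) + ennreal c * (ennreal (p x / c) * ?F2 x)" for x
        using c np0[of x]
        by (auto simp: \<rho>_def n_def p_def mult.assoc[symmetric] ennreal_mult[symmetric] ennreal_neg)
      then have "(\<integral>\<^sup>+x. ennreal \<bar>g x\<bar> * (\<integral>\<^sup>+b. f (x, b) \<partial>\<rho> x) \<partial>\<mu>) =
          (\<integral>\<^sup>+x. ennreal c * (ennreal (n x / c) * ?F1 x) + ennreal c * (ennreal (p x / c) * ?F2 x) \<partial>\<mu>)"
        by simp
      also have "\<dots> = ennreal c * (\<integral>\<^sup>+x. ennreal (n x / c) * ?F1 x \<partial>\<mu>) + ennreal c * (\<integral>\<^sup>+x. ennreal (p x / c) * ?F2 x \<partial>\<mu>)"
        using F w by (subst nn_integral_add) (auto simp: nn_integral_cmult)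
      also have "(\<integral>\<^sup>+x. ennreal (n x / c) * ?F1 x \<partial>\<mu>) = (\<integral>\<^sup>+x. ?F1 x \<partial>?P)"
        by (rule nn_integral_density[OF w(1) F(1), symmetric])
      also have "\<dots> = (\<integral>\<^sup>+z. f z \<partial>\<gamma>)"
        using nn_integral_is_disintegration[OF d(1) \<gamma>(1,2) f] by (simp add: \<gamma>(3))
      also have "(\<integral>\<^sup>+x. ennreal (p x / c) * ?F2 x \<partial>\<mu>) = (\<integral>\<^sup>+x. ?F2 x \<partial>?Q)"
        by (rule nn_integral_density[OF w(2) F(2), symmetric])
      also have "\<dots> = (\<integral>\<^sup>+z. f z \<partial>?\<gamma>')"
        using nn_integral_is_disintegration[OF d(2) \<gamma>'(1,2) f] by (simp add: \<gamma>'(3))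
      also have "\<dots> = (\<integral>\<^sup>+z. f (prod.swap z) \<partial>\<gamma>)"
        using f by (intro nn_integral_distr[OF sw]) simp
      finally show ?thesis .
    qed
    show ?thesis
    proof (intro exI[of _ \<rho>] conjI ballI \<rho> supp)
      fix f :: "real \<times> real \<Rightarrow> ennreal" assume f[measurable]: "f \<in> borel_measurable borel"
      have "prod.swap \<in> borel \<rightarrow>\<^sub>M (borel :: (real \<times> real) measure)"
        unfolding prod.swap_def borel_prod[symmetric] by measurable
      then have f': "(\<lambda>z. f (prod.swap z)) \<in> borel_measurable borel"
        by (rule measurable_compose[OF _ f])
      show "(\<integral>\<^sup>+x. ennreal \<bar>g x\<bar> * (\<integral>\<^sup>+b. f (x, b) \<partial>\<rho> x) \<partial>\<mu>) =
        (\<integral>\<^sup>+x. ennreal \<bar>g x\<bar> * (\<integral>\<^sup>+b. f (b, x) \<partial>\<rho> x) \<partial>\<mu>)"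
        using I[OF f] I[OF f'] by (simp add: add.commute)
    qed
  qed
qed

subsection \<open>Exchanging mass between kernels\<close>

lemma measurable_nn_integral_kernel [measurable (raw)]:
  assumes "L \<in> M \<rightarrow>\<^sub>M prob_algebra N"
    and "(\<lambda>z. f (fst z) (snd z)) \<in> borel_measurable (M \<Otimes>\<^sub>M N)"
  shows "(\<lambda>x. \<integral>\<^sup>+y. f x y \<partial>L x) \<in> borel_measurable M"
  using assms by (intro nn_integral_measurable_subprob_algebra2[where N = N])
    (auto simp: case_prod_unfold intro: measurable_prob_algebraD)

lemma nn_integral_bind_prob:
  assumes "N \<in> borel \<rightarrow>\<^sub>M prob_algebra B" "sets M = sets borel" "f \<in> borel_measurable B"
  shows "(\<integral>\<^sup>+x. f x \<partial>(M \<bind> N)) = (\<integral>\<^sup>+x. \<integral>\<^sup>+y. f y \<partial>N x \<partial>M)"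
  using assms measurable_prob_algebraD[OF assms(1)]
  by (intro nn_integral_bind) (simp_all add: measurable_cong_sets[OF assms(2) refl])

text \<open>On the right \<open>ennreal\<close> cuts \<open>f\<close> off at 0, so this is the
  integral of the positive part.\<close>

lemma ennreal_integral_le_nn_integral:
  assumes "integrable M f"
  shows "ennreal (\<integral>x. f x \<partial>M) \<le> (\<integral>\<^sup>+x. ennreal (f x) \<partial>M)"
proof -
  have "(\<integral>x. f x \<partial>M) \<le> (\<integral>x. max 0 (f x) \<partial>M)"
    using assms by (intro integral_mono) auto
  also have "ennreal (\<integral>x. max 0 (f x) \<partial>M) = (\<integral>\<^sup>+x. ennreal (max 0 (f x)) \<partial>M)"
    using assms by (intro nn_integral_eq_integral[symmetric]) auto
  finally show ?thesis
    by (simp add: ennreal_leI max_def cong: if_cong)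
       (smt (verit, best) ennreal_leI ennreal_neg nn_integral_cong)
qed

text \<open>The uniform law carried over to the Borel sets of the whole line, so that it can be
  combined with kernels there.\<close>

abbreviation unit_uniform :: "real measure" where
  "unit_uniform \<equiv> distr unit_lborel borel (\<lambda>u. u)"

lemma unit_uniform_prob_algebra [measurable (raw)]: "unit_uniform \<in> space (prob_algebra borel)"
proof -
  have "(\<lambda>u. u) \<in> unit_lborel \<rightarrow>\<^sub>M borel"
    by (intro measurable_restrict_space1) auto
  then show ?thesis
    using prob_space.prob_space_distr[OF prob_space_unit_lborel] by (simp add: space_prob_algebra)
qed

text \<open>The event \<open>u < w\<close> has probability \<open>w\<close>: the uniform variable is
  the coin that decides whether a swap takes place.\<close>

lemma nn_integral_unit_uniform_if:
  assumes "0 \<le> w" "w \<le> 1"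
  shows "(\<integral>\<^sup>+u. (if u < w then a else b) \<partial>unit_uniform) = ennreal w * a + ennreal (1 - w) * b"
proof -
  interpret U: prob_space unit_uniform
    using unit_uniform_prob_algebra by (simp add: space_prob_algebra)
  have m: "(\<lambda>u. u) \<in> unit_lborel \<rightarrow>\<^sub>M borel"
    by (intro measurable_restrict_space1) auto
  have "emeasure unit_uniform {..<w} = emeasure unit_lborel {u \<in> space unit_lborel. ennreal u < ennreal w}"
    using assms by (subst emeasure_distr[OF m])
      (auto simp: space_restrict_space ennreal_less_iff intro!: arg_cong[where f = "emeasure _"])
  also have "\<dots> = ennreal w"
    using assms by (intro emeasure_unit_lborel_less) simp
  finally have 1: "emeasure unit_uniform {..<w} = ennreal w" .
  have "emeasure unit_uniform (space unit_uniform - {..<w}) = 1 - ennreal w"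
    using 1 U.emeasure_space_1 by (subst emeasure_compl) auto
  also have "\<dots> = ennreal (1 - w)"
    using assms by (simp add: ennreal_minus flip: ennreal_1)
  finally have 2: "emeasure unit_uniform (- {..<w}) = ennreal (1 - w)"
    by (simp add: Compl_eq_Diff_UNIV)
  have "(\<integral>\<^sup>+u. (if u < w then a else b) \<partial>unit_uniform) =
      (\<integral>\<^sup>+u. a * indicator {..<w} u + b * indicator (- {..<w}) u \<partial>unit_uniform)"
    by (intro nn_integral_cong) (auto simp: indicator_def)
  also have "\<dots> = a * ennreal w + b * ennreal (1 - w)"
    using 1 2 by (subst nn_integral_add) (auto simp: nn_integral_cmult_indicator)
  finally show ?thesis by (simp add: mult.commute)
qed

text \<open>\<open>\<kappa>\<close> is the disintegration to be corrected and
  \<open>\<rho> x\<close> the law of the partner of \<open>x\<close>. The symmetry of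
  \<open>\<rho>\<close> and the signs of the drifts are hypotheses of the individual lemmas.\<close>

locale kernel_exchange =
  fixes \<kappa> \<rho> :: "real \<Rightarrow> real measure"
  assumes \<kappa>[measurable]: "\<kappa> \<in> borel \<rightarrow>\<^sub>M prob_algebra borel"
    and \<rho>[measurable]: "\<rho> \<in> borel \<rightarrow>\<^sub>M prob_algebra borel"
begin

definition drift :: "real \<Rightarrow> real" where
  "drift x = (\<integral>y. y - x \<partial>\<kappa> x)"

text \<open>How far replacing \<open>y\<close> by \<open>z\<close> pushes the kernel at
  \<open>x\<close> against its own drift. For zero drift the sign is arbitrary:
  \<open>weight\<close> is then 0 and nothing moves.\<close>

definition gain :: "real \<Rightarrow> real \<Rightarrow> real \<Rightarrow> real" where
  "gain x y z = (if drift x < 0 then z - y else y - z)"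

text \<open>As \<open>ennreal\<close> cuts off at 0, this is the expected correction if every swap
  with positive gain were carried out.\<close>

definition full_gain :: "real \<Rightarrow> real \<Rightarrow> ennreal" where
  "full_gain x b = (\<integral>\<^sup>+y. \<integral>\<^sup>+z. ennreal (gain x y z) \<partial>\<kappa> b \<partial>\<kappa> x)"

text \<open>
  On the pairs that matter the quotient lies in \<open>(0, 1]\<close>. Elsewhere \<open>full_gain\<close> may be zero or infinite,
  which makes the quotient zero, or the quotient may exceed one; the minimum keeps it a probability.
\<close>

definition weight :: "real \<Rightarrow> real \<Rightarrow> real" where
  "weight x b = min 1 (\<bar>drift x\<bar> / enn2real (full_gain x b))"

definition move :: "real \<Rightarrow> real \<Rightarrow> real \<Rightarrow> real \<Rightarrow> real \<Rightarrow> real" where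
  "move x b y z u = (if 0 < gain x y z \<and> u < weight x b then z else y)"

text \<open>The joint law of the old and the new position, hence a coupling of both kernels. The
  other half of a swap is not recorded here; it is accounted for when the partner draws its own
  partner, by the symmetry of \<open>\<rho>\<close>.\<close>

definition exchange :: "real \<Rightarrow> (real \<times> real) measure" where
  "exchange x = \<rho> x \<bind> (\<lambda>b. \<kappa> x \<bind> (\<lambda>y. \<kappa> b \<bind> (\<lambda>z. unit_uniform \<bind> (\<lambda>u.
    return (borel \<Otimes>\<^sub>M borel) (y, move x b y z u)))))"

lemma \<kappa>_prob: "prob_space (\<kappa> x)" and sets_\<kappa>: "sets (\<kappa> x) = sets borel" and space_\<kappa>: "space (\<kappa> x) = UNIV"
  using \<kappa>[THEN measurable_space, of x] sets_eq_imp_space_eq[of "\<kappa> x" borel] by (auto simp: space_prob_algebra)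

lemma \<rho>_prob: "prob_space (\<rho> x)" and sets_\<rho>: "sets (\<rho> x) = sets borel" and space_\<rho>: "space (\<rho> x) = UNIV"
  using \<rho>[THEN measurable_space, of x] sets_eq_imp_space_eq[of "\<rho> x" borel] by (auto simp: space_prob_algebra)

lemma \<kappa>_space [measurable (raw)]: "\<kappa> x \<in> space (prob_algebra borel)"
  by (simp add: space_prob_algebra \<kappa>_prob sets_\<kappa>)

lemma measurable_drift [measurable]: "drift \<in> borel_measurable borel"
  unfolding drift_def[abs_def]
  using borel_measurable_kernel_integral[OF _ \<kappa>, of "\<lambda>z. snd z - fst z"] by simp

lemma measurable_gain [measurable (raw)]:
  assumes [measurable]: "a \<in> borel_measurable M" "b \<in> borel_measurable M" "c \<in> borel_measurable M"
  shows "(\<lambda>x. gain (a x) (b x) (c x)) \<in> borel_measurable M"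
  unfolding gain_def by measurable

lemma measurable_full_gain [measurable (raw)]:
  assumes [measurable]: "a \<in> borel_measurable M" "b \<in> borel_measurable M"
  shows "(\<lambda>x. full_gain (a x) (b x)) \<in> borel_measurable M"
  unfolding full_gain_def by measurable

lemma measurable_weight [measurable (raw)]:
  assumes [measurable]: "a \<in> borel_measurable M" "b \<in> borel_measurable M"
  shows "(\<lambda>x. weight (a x) (b x)) \<in> borel_measurable M"
  unfolding weight_def by measurable

lemma weight_nonneg: "0 \<le> weight x b" and weight_le_1: "weight x b \<le> 1"
  by (simp_all add: weight_def)

lemma measurable_move [measurable (raw)]:
  assumes [measurable]: "a \<in> borel_measurable M" "b \<in> borel_measurable M" "c \<in> borel_measurable M"
    "d \<in> borel_measurable M" "e \<in> borel_measurable M"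
  shows "(\<lambda>x. move (a x) (b x) (c x) (d x) (e x)) \<in> borel_measurable M"
  unfolding move_def by measurable

lemma exchange_kernel [measurable]: "exchange \<in> borel \<rightarrow>\<^sub>M prob_algebra (borel \<Otimes>\<^sub>M borel)"
  unfolding exchange_def[abs_def] by measurable

text \<open>Integrating out the coin leaves a mixture with weight \<open>weight x b\<close>. The
  later computations of marginals and gains start from this formula.\<close>

lemma nn_integral_exchange:
  assumes f[measurable]: "f \<in> borel_measurable (borel \<Otimes>\<^sub>M borel)"
  shows "(\<integral>\<^sup>+p. f p \<partial>exchange x) = (\<integral>\<^sup>+b. \<integral>\<^sup>+y. \<integral>\<^sup>+z. (if 0 < gain x y z
      then ennreal (weight x b) * f (y, z) + ennreal (1 - weight x b) * f (y, y) else f (y, y)) \<partial>\<kappa> b \<partial>\<kappa> x \<partial>\<rho> x)"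
proof -
  interpret U: prob_space unit_uniform
    using unit_uniform_prob_algebra by (simp add: space_prob_algebra)
  have bind: "(\<integral>\<^sup>+p. f p \<partial>exchange x) = (\<integral>\<^sup>+b. \<integral>\<^sup>+y. \<integral>\<^sup>+z. \<integral>\<^sup>+u. f (y, move x b y z u) \<partial>unit_uniform \<partial>\<kappa> b \<partial>\<kappa> x \<partial>\<rho> x)"
    unfolding exchange_def
    apply (subst nn_integral_bind_prob[OF _ sets_\<rho> f], measurable)
    apply (intro nn_integral_cong)
    apply (subst nn_integral_bind_prob[OF _ sets_\<kappa> f], measurable)
    apply (intro nn_integral_cong)
    apply (subst nn_integral_bind_prob[OF _ sets_\<kappa> f], measurable)
    apply (intro nn_integral_cong)
    apply (subst nn_integral_bind_prob[OF _ _ f], measurable)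
    apply (intro nn_integral_cong)
    apply (subst nn_integral_return)
      apply (auto simp: space_pair_measure)
    done
  have uniform: "(\<integral>\<^sup>+u. f (y, move x b y z u) \<partial>unit_uniform) = (if 0 < gain x y z
      then ennreal (weight x b) * f (y, z) + ennreal (1 - weight x b) * f (y, y) else f (y, y))" for b y z
  proof (cases "0 < gain x y z")
    case True
    have "(\<integral>\<^sup>+u. f (y, move x b y z u) \<partial>unit_uniform) = (\<integral>\<^sup>+u. (if u < weight x b then f (y, z) else f (y, y)) \<partial>unit_uniform)"
      using True by (intro nn_integral_cong) (simp add: move_def)
    then show ?thesis
      using True nn_integral_unit_uniform_if[OF weight_nonneg weight_le_1] by simp
  next
    case False
    then show ?thesis
      using U.emeasure_space_1 by (simp add: move_def)
  qed
  show ?thesis unfolding bind uniform ..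
qed

text \<open>The old position does not depend on the coin, so the two weights recombine to 1.\<close>

lemma nn_integral_exchange_fst:
  assumes f[measurable]: "f \<in> borel_measurable borel"
  shows "(\<integral>\<^sup>+p. f (fst p) \<partial>exchange x) = (\<integral>\<^sup>+y. f y \<partial>\<kappa> x)"
proof -
  have split: "ennreal (weight x b) * a + ennreal (1 - weight x b) * a = a" for b a
    using weight_nonneg[of x b] weight_le_1[of x b] by (simp flip: distrib_right ennreal_plus)
  have "(\<integral>\<^sup>+p. f (fst p) \<partial>exchange x) = (\<integral>\<^sup>+b. \<integral>\<^sup>+y. \<integral>\<^sup>+z. f y \<partial>\<kappa> b \<partial>\<kappa> x \<partial>\<rho> x)"
    by (subst nn_integral_exchange) (simp_all only: fst_conv split if_cancel, measurable)
  also have "\<dots> = (\<integral>\<^sup>+y. f y \<partial>\<kappa> x)"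
    using prob_space.emeasure_space_1[OF \<kappa>_prob] prob_space.emeasure_space_1[OF \<rho>_prob] by simp
  finally show ?thesis .
qed

section \<open>Opposed pairs and the size of the correction\<close>

definition opposed :: "real \<Rightarrow> real \<Rightarrow> bool" where
  "opposed x b \<longleftrightarrow> (drift x < 0 \<and> 0 < drift b \<and> x \<le> b) \<or> (0 < drift x \<and> drift b < 0 \<and> b \<le> x)"

text \<open>A swap that raises one kernel lowers the other by the same amount; with drifts of
  opposite sign both count it as the same gain.\<close>

lemma gain_opposed: "opposed x b \<Longrightarrow> gain b z y = gain x y z"
  by (auto simp: opposed_def gain_def)

text \<open>A kernel without a mean has \<open>drift x = 0\<close>, the default value of the Bochner integral.\<close>

lemma drift_nonzero_mean:
  assumes "drift x \<noteq> 0"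
  shows "integrable (\<kappa> x) (\<lambda>y. y)" "(\<integral>y. y \<partial>\<kappa> x) = x + drift x"
proof -
  interpret prob_space "\<kappa> x" by (rule \<kappa>_prob)
  have "integrable (\<kappa> x) (\<lambda>y. y - x)"
    using assms not_integrable_integral_eq unfolding drift_def by blast
  then have "integrable (\<kappa> x) (\<lambda>y. (y - x) + x)"
    by (intro Bochner_Integration.integrable_add) auto
  then show i: "integrable (\<kappa> x) (\<lambda>y. y)" by simp
  then show "(\<integral>y. y \<partial>\<kappa> x) = x + drift x"
    unfolding drift_def by (simp add: prob_space)
qed

text \<open>Without the cut-off, the mean gain of a full swap is the difference of the two means,
  which is at least \<open>\<bar>drift x\<bar>\<close> in the right direction; the cut-off only
  increases it. Finiteness comes from the first moments of both kernels.\<close>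

lemma full_gain_bounds:
  assumes "opposed x b"
  shows "ennreal \<bar>drift x\<bar> \<le> full_gain x b" "full_gain x b < \<infinity>"
proof -
  define s :: real where "s = (if drift x < 0 then 1 else -1)"
  have gain: "gain x y z = s * (z - y)" for y z
    by (simp add: gain_def s_def)
  have nz: "drift x \<noteq> 0" "drift b \<noteq> 0" using assms by (auto simp: opposed_def)
  note mx = drift_nonzero_mean[OF nz(1)] and mb = drift_nonzero_mean[OF nz(2)]
  interpret x: prob_space "\<kappa> x" by (rule \<kappa>_prob)
  interpret b: prob_space "\<kappa> b" by (rule \<kappa>_prob)
  \<comment> \<open>For an opposed pair \<open>s\<close> is the common weak sign of
    \<open>b - x\<close>, \<open>drift b\<close> and \<open>- drift x\<close>, so the right side is
    the sum of their moduli. The order of \<open>x\<close> and \<open>b\<close> is used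
    here.\<close>
  have "\<bar>drift x\<bar> \<le> s * ((b + drift b) - (x + drift x))"
    using assms by (auto simp: opposed_def s_def)
  also have "\<dots> = (\<integral>y. s * ((b + drift b) - y) \<partial>\<kappa> x)"
    using mx by (simp add: x.prob_space)
  finally have "ennreal \<bar>drift x\<bar> \<le> ennreal (\<integral>y. s * ((b + drift b) - y) \<partial>\<kappa> x)"
    by (rule ennreal_leI)
  \<comment> \<open>Passing to positive parts can only increase an expectation; this is done in the
    outer integral first and then in the inner one.\<close>
  also have "\<dots> \<le> (\<integral>\<^sup>+y. ennreal (s * ((b + drift b) - y)) \<partial>\<kappa> x)"
    using mx by (intro ennreal_integral_le_nn_integral) auto
  also have "\<dots> \<le> full_gain x b"
    unfolding full_gain_def
  proof (rule nn_integral_mono)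
    fix y
    have "ennreal (s * ((b + drift b) - y)) = ennreal (\<integral>z. s * (z - y) \<partial>\<kappa> b)"
      using mb by (simp add: b.prob_space)
    also have "\<dots> \<le> (\<integral>\<^sup>+z. ennreal (s * (z - y)) \<partial>\<kappa> b)"
      using mb by (intro ennreal_integral_le_nn_integral) auto
    finally show "ennreal (s * ((b + drift b) - y)) \<le> (\<integral>\<^sup>+z. ennreal (gain x y z) \<partial>\<kappa> b)"
      by (simp add: gain)
  qed
  finally show "ennreal \<bar>drift x\<bar> \<le> full_gain x b" .
  have fin: "(\<integral>\<^sup>+y. ennreal \<bar>y\<bar> \<partial>\<kappa> x) < \<infinity>" "(\<integral>\<^sup>+z. ennreal \<bar>z\<bar> \<partial>\<kappa> b) < \<infinity>"
    using mx(1)[unfolded integrable_iff_bounded] mb(1)[unfolded integrable_iff_bounded] by simp_all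
  have ms: "(\<lambda>y. ennreal \<bar>y\<bar>) \<in> borel_measurable (\<kappa> t)" for t
    by (simp add: measurable_cong_sets[OF sets_\<kappa> refl])
  have "full_gain x b \<le> (\<integral>\<^sup>+y. \<integral>\<^sup>+z. ennreal \<bar>y\<bar> + ennreal \<bar>z\<bar> \<partial>\<kappa> b \<partial>\<kappa> x)"
    unfolding full_gain_def gain
  proof (intro nn_integral_mono)
    fix y z
    have "s * (z - y) \<le> \<bar>y\<bar> + \<bar>z\<bar>" unfolding s_def by auto
    then show "ennreal (s * (z - y)) \<le> ennreal \<bar>y\<bar> + ennreal \<bar>z\<bar>"
      unfolding ennreal_plus[OF abs_ge_zero abs_ge_zero, symmetric] by (rule ennreal_leI)
  qed
  also have "\<dots> = (\<integral>\<^sup>+y. ennreal \<bar>y\<bar> \<partial>\<kappa> x) + (\<integral>\<^sup>+z. ennreal \<bar>z\<bar> \<partial>\<kappa> b)"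
    using ms x.emeasure_space_1 b.emeasure_space_1 by (simp add: nn_integral_add)
  also have "\<dots> < \<infinity>" using fin by simp
  finally show "full_gain x b < \<infinity>" .
qed

lemma nn_integral_\<kappa>_swap:
  assumes F: "(\<lambda>p. F (fst p) (snd p)) \<in> borel_measurable (borel \<Otimes>\<^sub>M borel)"
  shows "(\<integral>\<^sup>+z. \<integral>\<^sup>+y. F y z \<partial>\<kappa> x \<partial>\<kappa> b) = (\<integral>\<^sup>+y. \<integral>\<^sup>+z. F y z \<partial>\<kappa> b \<partial>\<kappa> x)"
proof -
  interpret x: prob_space "\<kappa> x" by (rule \<kappa>_prob)
  interpret b: prob_space "\<kappa> b" by (rule \<kappa>_prob)
  interpret pair_sigma_finite "\<kappa> x" "\<kappa> b" ..
  have "sets (\<kappa> x \<Otimes>\<^sub>M \<kappa> b) = sets (borel \<Otimes>\<^sub>M borel)"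
    by (rule sets_pair_measure_cong[OF sets_\<kappa> sets_\<kappa>])
  with F show ?thesis
    by (intro Fubini') (simp add: case_prod_unfold measurable_cong_sets[of "\<kappa> x \<Otimes>\<^sub>M \<kappa> b" "borel \<Otimes>\<^sub>M borel"])
qed

text \<open>Both points see the same gain in a swap, and Fubini interchanges the two draws.\<close>

lemma full_gain_opposed: "opposed x b \<Longrightarrow> full_gain b x = full_gain x b"
  unfolding full_gain_def by (subst nn_integral_\<kappa>_swap) (simp_all add: gain_opposed)

text \<open>The first identity says that the mean moves by exactly the required amount. The second
  separates \<open>\<bar>drift x\<bar>\<close> from a factor symmetric in \<open>x\<close> and
  \<open>b\<close>, which is what the balance of mass needs.\<close>

lemma weight_opposed:
  assumes "opposed x b"
  shows "ennreal (weight x b) * full_gain x b = ennreal \<bar>drift x\<bar>"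
    "ennreal (weight x b) = ennreal \<bar>drift x\<bar> * ennreal (1 / enn2real (full_gain x b))"
proof -
  obtain d where d: "full_gain x b = ennreal d" "0 \<le> d"
    using full_gain_bounds(2)[OF assms] by (cases "full_gain x b") auto
  have "\<bar>drift x\<bar> \<le> d" using full_gain_bounds(1)[OF assms] d by simp
  moreover have "0 < \<bar>drift x\<bar>" using assms by (auto simp: opposed_def)
  ultimately have "0 < d" "weight x b = \<bar>drift x\<bar> / d"
    using d by (auto simp: weight_def min_def)
  then show "ennreal (weight x b) * full_gain x b = ennreal \<bar>drift x\<bar>"
    "ennreal (weight x b) = ennreal \<bar>drift x\<bar> * ennreal (1 / enn2real (full_gain x b))"
    using d by (simp_all flip: ennreal_mult)
qed

text \<open>Only swaps with positive gain are carried out, so the negative part vanishes. For each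
  opposed partner the expected gain is \<open>weight\<close> times \<open>full_gain\<close>, that is
  \<open>\<bar>drift x\<bar>\<close>; for zero drift the weight is 0.\<close>

lemma
  assumes opp: "drift x \<noteq> 0 \<longrightarrow> (AE b in \<rho> x. opposed x b)"
  shows nn_integral_gain_exchange: "(\<integral>\<^sup>+p. ennreal (gain x (fst p) (snd p)) \<partial>exchange x) = ennreal \<bar>drift x\<bar>"
    and nn_integral_neg_gain_exchange: "(\<integral>\<^sup>+p. ennreal (- gain x (fst p) (snd p)) \<partial>exchange x) = 0"
proof -
  interpret \<rho>: prob_space "\<rho> x" by (rule \<rho>_prob)
  have [simp]: "gain x y y = 0" for y by (simp add: gain_def)
  have "(\<integral>\<^sup>+p. ennreal (gain x (fst p) (snd p)) \<partial>exchange x) =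
      (\<integral>\<^sup>+b. \<integral>\<^sup>+y. \<integral>\<^sup>+z. ennreal (weight x b) * ennreal (gain x y z) \<partial>\<kappa> b \<partial>\<kappa> x \<partial>\<rho> x)"
    by (subst nn_integral_exchange) (auto intro!: nn_integral_cong simp: ennreal_neg not_less)
  also have "\<dots> = (\<integral>\<^sup>+b. ennreal (weight x b) * full_gain x b \<partial>\<rho> x)"
  proof (rule nn_integral_cong)
    fix b
    have m: "(\<lambda>z. ennreal (gain x y z)) \<in> borel_measurable (\<kappa> b)" for y
      by (simp add: measurable_cong_sets[OF sets_\<kappa> refl])
    have "(\<lambda>y. \<integral>\<^sup>+z. ennreal (gain x y z) \<partial>\<kappa> b) \<in> borel_measurable borel" by measurable
    then have m': "(\<lambda>y. \<integral>\<^sup>+z. ennreal (gain x y z) \<partial>\<kappa> b) \<in> borel_measurable (\<kappa> x)"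
      by (simp add: measurable_cong_sets[OF sets_\<kappa> refl])
    show "(\<integral>\<^sup>+y. \<integral>\<^sup>+z. ennreal (weight x b) * ennreal (gain x y z) \<partial>\<kappa> b \<partial>\<kappa> x) = ennreal (weight x b) * full_gain x b"
      unfolding full_gain_def using m m' by (simp add: nn_integral_cmult)
  qed
  also have "\<dots> = (\<integral>\<^sup>+b. ennreal \<bar>drift x\<bar> \<partial>\<rho> x)"
  proof (cases "drift x = 0")
    case True
    then show ?thesis by (simp add: weight_def)
  next
    case False
    with opp have "AE b in \<rho> x. opposed x b" by simp
    then show ?thesis by (intro nn_integral_cong_AE) (auto simp: weight_opposed(1) elim!: eventually_mono)
  qed
  also have "\<dots> = ennreal \<bar>drift x\<bar>" using \<rho>.emeasure_space_1 by simp
  finally show "(\<integral>\<^sup>+p. ennreal (gain x (fst p) (snd p)) \<partial>exchange x) = ennreal \<bar>drift x\<bar>" .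
  show "(\<integral>\<^sup>+p. ennreal (- gain x (fst p) (snd p)) \<partial>exchange x) = 0"
    by (subst nn_integral_exchange) (auto intro!: nn_integral_zero' AE_I2 simp: ennreal_neg cong: if_cong)
qed

section \<open>Balance of the exchanged mass\<close>

declare sets_\<kappa> [measurable_cong] sets_\<rho> [measurable_cong]

lemma nn_integral_triple_add:
  assumes [measurable]: "(\<lambda>p. F (fst (fst p)) (snd (fst p)) (snd p)) \<in> borel_measurable ((borel \<Otimes>\<^sub>M borel) \<Otimes>\<^sub>M borel)"
    "(\<lambda>p. G (fst (fst p)) (snd (fst p)) (snd p)) \<in> borel_measurable ((borel \<Otimes>\<^sub>M borel) \<Otimes>\<^sub>M borel)"
  shows "(\<integral>\<^sup>+b. \<integral>\<^sup>+y. \<integral>\<^sup>+z. F b y z + G b y z \<partial>\<kappa> b \<partial>\<kappa> x \<partial>\<rho> x) =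
    (\<integral>\<^sup>+b. \<integral>\<^sup>+y. \<integral>\<^sup>+z. F b y z \<partial>\<kappa> b \<partial>\<kappa> x \<partial>\<rho> x) + (\<integral>\<^sup>+b. \<integral>\<^sup>+y. \<integral>\<^sup>+z. G b y z \<partial>\<kappa> b \<partial>\<kappa> x \<partial>\<rho> x)"
proof -
  have c: "(\<lambda>p. (\<lambda>q. H (fst (fst q)) (snd (fst q)) (snd q)) ((b, fst p), snd p)) \<in> borel_measurable (borel \<Otimes>\<^sub>M borel)"
    if "(\<lambda>q. H (fst (fst q)) (snd (fst q)) (snd q)) \<in> borel_measurable ((borel \<Otimes>\<^sub>M borel) \<Otimes>\<^sub>M borel)"
    for H :: "real \<Rightarrow> real \<Rightarrow> real \<Rightarrow> ennreal" and b
    by (rule measurable_compose[OF _ that]) measurable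
  have 2[measurable]: "(\<lambda>p. F b (fst p) (snd p)) \<in> borel_measurable (borel \<Otimes>\<^sub>M borel)"
    "(\<lambda>p. G b (fst p) (snd p)) \<in> borel_measurable (borel \<Otimes>\<^sub>M borel)" for b
    using c[OF assms(1), of b] c[OF assms(2), of b] by simp_all
  have 3[measurable]: "F b y \<in> borel_measurable borel" "G b y \<in> borel_measurable borel" for b y
    using measurable_compose[OF measurable_Pair1' 2(1), of y] measurable_compose[OF measurable_Pair1' 2(2), of y] by simp_all
  show ?thesis
    by (simp add: nn_integral_add)
qed

text \<open>Detailed balance: the mass leaving the kernels, tested by \<open>h\<close> at its old
  position \<open>y\<close>, equals the mass entering them, tested at \<open>z\<close>. What leaves
  \<open>x\<close> towards \<open>b\<close> is what \<open>b\<close> receives, and the symmetry of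
  \<open>\<rho>\<close> exchanges the two roles.\<close>

lemma exchange_balance:
  assumes \<mu>: "prob_space \<mu>" "sets \<mu> = sets borel"
    and sym: "\<And>f. f \<in> borel_measurable borel \<Longrightarrow>
      (\<integral>\<^sup>+x. ennreal \<bar>drift x\<bar> * (\<integral>\<^sup>+b. f (x, b) \<partial>\<rho> x) \<partial>\<mu>) = (\<integral>\<^sup>+x. ennreal \<bar>drift x\<bar> * (\<integral>\<^sup>+b. f (b, x) \<partial>\<rho> x) \<partial>\<mu>)"
    and opp: "AE x in \<mu>. drift x \<noteq> 0 \<longrightarrow> (AE b in \<rho> x. opposed x b)"
    and h[measurable]: "h \<in> borel_measurable borel"
  shows "(\<integral>\<^sup>+x. \<integral>\<^sup>+b. \<integral>\<^sup>+y. \<integral>\<^sup>+z. (if 0 < gain x y z then ennreal (weight x b) * h y else 0) \<partial>\<kappa> b \<partial>\<kappa> x \<partial>\<rho> x \<partial>\<mu>) =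
    (\<integral>\<^sup>+x. \<integral>\<^sup>+b. \<integral>\<^sup>+y. \<integral>\<^sup>+z. (if 0 < gain x y z then ennreal (weight x b) * h z else 0) \<partial>\<kappa> b \<partial>\<kappa> x \<partial>\<rho> x \<partial>\<mu>)"
proof -
  \<comment> \<open>The outgoing mass per unit of \<open>\<bar>drift x\<bar>\<close> for a pair of
    points; the normalisation \<open>1 / full_gain\<close> is the same seen from either
    point.\<close>
  define f where "f p = ennreal (1 / enn2real (full_gain (fst p) (snd p))) *
    (\<integral>\<^sup>+y. \<integral>\<^sup>+z. (if 0 < gain (fst p) y z then h y else 0) \<partial>\<kappa> (snd p) \<partial>\<kappa> (fst p))" for p
  have f: "f \<in> borel_measurable borel"
    unfolding f_def[abs_def] borel_prod[symmetric] by measurable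
  have pull: "(\<integral>\<^sup>+y. \<integral>\<^sup>+z. (if 0 < gain x y z then c * k y z else 0) \<partial>\<kappa> b \<partial>\<kappa> x) =
      c * (\<integral>\<^sup>+y. \<integral>\<^sup>+z. (if 0 < gain x y z then k y z else 0) \<partial>\<kappa> b \<partial>\<kappa> x)"
    if [measurable]: "(\<lambda>p. k (fst p) (snd p)) \<in> borel_measurable (borel \<Otimes>\<^sub>M borel)"
    for x b c and k :: "real \<Rightarrow> real \<Rightarrow> ennreal"
  proof -
    have [measurable]: "k y \<in> borel_measurable borel" for y
      using measurable_compose[OF measurable_Pair1' that, of y] by simp
    have "(if 0 < gain x y z then c * k y z else 0) = c * (if 0 < gain x y z then k y z else 0)" for y z
      by simp
    then show ?thesis by (simp add: nn_integral_cmult)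
  qed
  have 1: "(\<integral>\<^sup>+b. \<integral>\<^sup>+y. \<integral>\<^sup>+z. (if 0 < gain x y z then ennreal (weight x b) * h y else 0) \<partial>\<kappa> b \<partial>\<kappa> x \<partial>\<rho> x) =
        ennreal \<bar>drift x\<bar> * (\<integral>\<^sup>+b. f (x, b) \<partial>\<rho> x)"
    and 2: "(\<integral>\<^sup>+b. \<integral>\<^sup>+y. \<integral>\<^sup>+z. (if 0 < gain x y z then ennreal (weight x b) * h z else 0) \<partial>\<kappa> b \<partial>\<kappa> x \<partial>\<rho> x) =
        ennreal \<bar>drift x\<bar> * (\<integral>\<^sup>+b. f (b, x) \<partial>\<rho> x)"
    if "drift x \<noteq> 0 \<longrightarrow> (AE b in \<rho> x. opposed x b)" for x
  proof -
    have fm: "(\<lambda>b. f (x, b)) \<in> borel_measurable (\<rho> x)" "(\<lambda>b. f (b, x)) \<in> borel_measurable (\<rho> x)"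
    proof -
      have "(\<lambda>b. (x, b)) \<in> \<rho> x \<rightarrow>\<^sub>M borel" "(\<lambda>b. (b, x)) \<in> \<rho> x \<rightarrow>\<^sub>M borel"
        unfolding borel_prod[symmetric] by measurable
      from this[THEN measurable_compose, OF f]
      show "(\<lambda>b. f (x, b)) \<in> borel_measurable (\<rho> x)" "(\<lambda>b. f (b, x)) \<in> borel_measurable (\<rho> x)" .
    qed
    \<comment> \<open>With zero drift the weight is 0 and both sides below vanish, so opposed pairs
      are the only other case.\<close>
    have AE: "AE b in \<rho> x. drift x = 0 \<or> opposed x b"
      using that by (cases "drift x = 0") auto
    show "(\<integral>\<^sup>+b. \<integral>\<^sup>+y. \<integral>\<^sup>+z. (if 0 < gain x y z then ennreal (weight x b) * h y else 0) \<partial>\<kappa> b \<partial>\<kappa> x \<partial>\<rho> x) =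
        ennreal \<bar>drift x\<bar> * (\<integral>\<^sup>+b. f (x, b) \<partial>\<rho> x)"
      unfolding nn_integral_cmult[OF fm(1), symmetric]
    proof (rule nn_integral_cong_AE, use AE in eventually_elim)
      case (elim b)
      have "(\<integral>\<^sup>+y. \<integral>\<^sup>+z. (if 0 < gain x y z then ennreal (weight x b) * h y else 0) \<partial>\<kappa> b \<partial>\<kappa> x) =
          ennreal (weight x b) * (\<integral>\<^sup>+y. \<integral>\<^sup>+z. (if 0 < gain x y z then h y else 0) \<partial>\<kappa> b \<partial>\<kappa> x)"
        by (rule pull) measurable
      also have "\<dots> = ennreal \<bar>drift x\<bar> * f (x, b)"
        using elim
      proof
        assume "opposed x b"
        then show ?thesis by (simp add: f_def weight_opposed(2) mult.assoc)
      qed (simp add: weight_def)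
      finally show ?case .
    qed
    show "(\<integral>\<^sup>+b. \<integral>\<^sup>+y. \<integral>\<^sup>+z. (if 0 < gain x y z then ennreal (weight x b) * h z else 0) \<partial>\<kappa> b \<partial>\<kappa> x \<partial>\<rho> x) =
        ennreal \<bar>drift x\<bar> * (\<integral>\<^sup>+b. f (b, x) \<partial>\<rho> x)"
      unfolding nn_integral_cmult[OF fm(2), symmetric]
    proof (rule nn_integral_cong_AE, use AE in eventually_elim)
      case (elim b)
      have "(\<integral>\<^sup>+y. \<integral>\<^sup>+z. (if 0 < gain x y z then ennreal (weight x b) * h z else 0) \<partial>\<kappa> b \<partial>\<kappa> x) =
          ennreal (weight x b) * (\<integral>\<^sup>+y. \<integral>\<^sup>+z. (if 0 < gain x y z then h z else 0) \<partial>\<kappa> b \<partial>\<kappa> x)"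
        by (rule pull) measurable
      also have "\<dots> = ennreal \<bar>drift x\<bar> * f (b, x)"
        using elim
      proof
        assume o: "opposed x b"
        \<comment> \<open>\<open>f (b, x)\<close> describes the swap starting from \<open>b\<close>,
          with \<open>z\<close> drawn there; equality of the gains and Fubini rewrite it as the swap
          seen from \<open>x\<close>.\<close>
        have "(\<integral>\<^sup>+z. \<integral>\<^sup>+y. (if 0 < gain b z y then h z else 0) \<partial>\<kappa> x \<partial>\<kappa> b) =
            (\<integral>\<^sup>+z. \<integral>\<^sup>+y. (if 0 < gain x y z then h z else 0) \<partial>\<kappa> x \<partial>\<kappa> b)"
          by (simp only: gain_opposed[OF o])
        also have "\<dots> = (\<integral>\<^sup>+y. \<integral>\<^sup>+z. (if 0 < gain x y z then h z else 0) \<partial>\<kappa> b \<partial>\<kappa> x)"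
          by (rule nn_integral_\<kappa>_swap) measurable
        finally show ?thesis
          by (simp add: f_def weight_opposed(2)[OF o] full_gain_opposed[OF o] mult.assoc)
      qed (simp add: weight_def)
      finally show ?case .
    qed
  qed
  have "(\<integral>\<^sup>+x. \<integral>\<^sup>+b. \<integral>\<^sup>+y. \<integral>\<^sup>+z. (if 0 < gain x y z then ennreal (weight x b) * h y else 0) \<partial>\<kappa> b \<partial>\<kappa> x \<partial>\<rho> x \<partial>\<mu>) =
      (\<integral>\<^sup>+x. ennreal \<bar>drift x\<bar> * (\<integral>\<^sup>+b. f (x, b) \<partial>\<rho> x) \<partial>\<mu>)"
    by (rule nn_integral_cong_AE, use opp in eventually_elim) (rule 1)
  also have "\<dots> = (\<integral>\<^sup>+x. ennreal \<bar>drift x\<bar> * (\<integral>\<^sup>+b. f (b, x) \<partial>\<rho> x) \<partial>\<mu>)"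
    by (rule sym[OF f])
  also have "\<dots> = (\<integral>\<^sup>+x. \<integral>\<^sup>+b. \<integral>\<^sup>+y. \<integral>\<^sup>+z. (if 0 < gain x y z then ennreal (weight x b) * h z else 0) \<partial>\<kappa> b \<partial>\<kappa> x \<partial>\<rho> x \<partial>\<mu>)"
    by (rule nn_integral_cong_AE, use opp in eventually_elim) (rule 2[symmetric])
  finally show ?thesis .
qed

text \<open>New mass plus outflow equals old mass plus inflow, an identity in which nothing is
  subtracted in \<open>ennreal\<close>. After averaging over \<open>\<mu>\<close> outflow and inflow
  agree and can be cancelled.\<close>

lemma nn_integral_exchange_snd:
  assumes \<mu>: "prob_space \<mu>" "sets \<mu> = sets borel"
    and sym: "\<And>f. f \<in> borel_measurable borel \<Longrightarrow>
      (\<integral>\<^sup>+x. ennreal \<bar>drift x\<bar> * (\<integral>\<^sup>+b. f (x, b) \<partial>\<rho> x) \<partial>\<mu>) = (\<integral>\<^sup>+x. ennreal \<bar>drift x\<bar> * (\<integral>\<^sup>+b. f (b, x) \<partial>\<rho> x) \<partial>\<mu>)"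
    and opp: "AE x in \<mu>. drift x \<noteq> 0 \<longrightarrow> (AE b in \<rho> x. opposed x b)"
    and h[measurable]: "h \<in> borel_measurable borel" and h1: "\<And>y. h y \<le> 1"
  shows "(\<integral>\<^sup>+x. \<integral>\<^sup>+p. h (snd p) \<partial>exchange x \<partial>\<mu>) = (\<integral>\<^sup>+x. \<integral>\<^sup>+y. h y \<partial>\<kappa> x \<partial>\<mu>)"
proof -
  interpret \<mu>: prob_space \<mu> by fact
  note [measurable_cong] = \<mu>(2)
  let ?A = "\<lambda>k x. \<integral>\<^sup>+b. \<integral>\<^sup>+y. \<integral>\<^sup>+z. (if 0 < gain x y z then ennreal (weight x b) * k y z else 0) \<partial>\<kappa> b \<partial>\<kappa> x \<partial>\<rho> x"
  let ?out = "?A (\<lambda>y z. h y)" and ?in = "?A (\<lambda>y z. h z)"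
  have one: "emeasure (\<kappa> x) UNIV = 1" "emeasure (\<rho> x) UNIV = 1" for x
    using prob_space.emeasure_space_1[OF \<kappa>_prob, of x] prob_space.emeasure_space_1[OF \<rho>_prob, of x]
    by (simp_all add: space_\<kappa> space_\<rho>)
  have wh: "ennreal (weight x b) * h y + ennreal (1 - weight x b) * h y = h y" for x b y
    using weight_nonneg[of x b] weight_le_1[of x b] by (simp flip: distrib_right ennreal_plus)
  have pt: "(\<integral>\<^sup>+p. h (snd p) \<partial>exchange x) + ?out x = (\<integral>\<^sup>+y. h y \<partial>\<kappa> x) + ?in x" for x
  proof -
    define F where "F b y z = (if 0 < gain x y z then ennreal (weight x b) * h z + ennreal (1 - weight x b) * h y else h y)"
      for b y z
    define G where "G b y z = (if 0 < gain x y z then ennreal (weight x b) * h y else 0)" for b y z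
    define H where "H b y z = (if 0 < gain x y z then ennreal (weight x b) * h z else 0)" for b y z
    have FGH: "F b y z + G b y z = h y + H b y z" for b y z
      using wh[of x b y] by (auto simp: F_def G_def H_def ac_simps)
    have m: "(\<lambda>p. F (fst (fst p)) (snd (fst p)) (snd p)) \<in> borel_measurable ((borel \<Otimes>\<^sub>M borel) \<Otimes>\<^sub>M borel)"
      "(\<lambda>p. G (fst (fst p)) (snd (fst p)) (snd p)) \<in> borel_measurable ((borel \<Otimes>\<^sub>M borel) \<Otimes>\<^sub>M borel)"
      "(\<lambda>p. H (fst (fst p)) (snd (fst p)) (snd p)) \<in> borel_measurable ((borel \<Otimes>\<^sub>M borel) \<Otimes>\<^sub>M borel)"
      "(\<lambda>p. h (snd (fst p))) \<in> borel_measurable ((borel \<Otimes>\<^sub>M borel) \<Otimes>\<^sub>M borel)"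
      unfolding F_def G_def H_def by measurable
    have "(\<integral>\<^sup>+p. h (snd p) \<partial>exchange x) = (\<integral>\<^sup>+b. \<integral>\<^sup>+y. \<integral>\<^sup>+z. F b y z \<partial>\<kappa> b \<partial>\<kappa> x \<partial>\<rho> x)"
      unfolding F_def by (subst nn_integral_exchange, measurable) (simp only: snd_conv)
    moreover have "(\<integral>\<^sup>+b. \<integral>\<^sup>+y. \<integral>\<^sup>+z. h y \<partial>\<kappa> b \<partial>\<kappa> x \<partial>\<rho> x) = (\<integral>\<^sup>+y. h y \<partial>\<kappa> x)"
      using one by (simp add: space_\<kappa> space_\<rho>)
    moreover have "?out x = (\<integral>\<^sup>+b. \<integral>\<^sup>+y. \<integral>\<^sup>+z. G b y z \<partial>\<kappa> b \<partial>\<kappa> x \<partial>\<rho> x)"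
      "?in x = (\<integral>\<^sup>+b. \<integral>\<^sup>+y. \<integral>\<^sup>+z. H b y z \<partial>\<kappa> b \<partial>\<kappa> x \<partial>\<rho> x)"
      by (simp_all only: G_def H_def)
    moreover note nn_integral_triple_add[of F G x, OF m(1,2)]
      nn_integral_triple_add[of "\<lambda>b y z. h y" H x, OF m(4,3)]
    ultimately show ?thesis by (simp only: FGH)
  qed
  have m[measurable]: "(\<lambda>x. \<integral>\<^sup>+p. h (snd p) \<partial>exchange x) \<in> borel_measurable borel" by measurable
  have "(\<integral>\<^sup>+x. \<integral>\<^sup>+p. h (snd p) \<partial>exchange x \<partial>\<mu>) + (\<integral>\<^sup>+x. ?out x \<partial>\<mu>) = (\<integral>\<^sup>+x. (\<integral>\<^sup>+p. h (snd p) \<partial>exchange x) + ?out x \<partial>\<mu>)"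
    by (rule nn_integral_add[symmetric]) measurable
  also have "\<dots> = (\<integral>\<^sup>+x. (\<integral>\<^sup>+y. h y \<partial>\<kappa> x) + ?in x \<partial>\<mu>)"
    by (simp only: pt)
  also have "\<dots> = (\<integral>\<^sup>+x. \<integral>\<^sup>+y. h y \<partial>\<kappa> x \<partial>\<mu>) + (\<integral>\<^sup>+x. ?in x \<partial>\<mu>)"
    by (rule nn_integral_add) measurable
  also have "(\<integral>\<^sup>+x. ?in x \<partial>\<mu>) = (\<integral>\<^sup>+x. ?out x \<partial>\<mu>)"
    by (rule exchange_balance[OF \<mu> sym opp h, symmetric])
  finally have eq: "(\<integral>\<^sup>+x. ?out x \<partial>\<mu>) + (\<integral>\<^sup>+x. \<integral>\<^sup>+p. h (snd p) \<partial>exchange x \<partial>\<mu>) =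
      (\<integral>\<^sup>+x. ?out x \<partial>\<mu>) + (\<integral>\<^sup>+x. \<integral>\<^sup>+y. h y \<partial>\<kappa> x \<partial>\<mu>)"
    by (simp only: add.commute)
  \<comment> \<open>Cancellation in \<open>ennreal\<close> requires a finite term; the bound
    \<open>h \<le> 1\<close> provides it.\<close>
  have "(\<integral>\<^sup>+x. ?out x \<partial>\<mu>) \<le> (\<integral>\<^sup>+x. \<integral>\<^sup>+b. \<integral>\<^sup>+y. \<integral>\<^sup>+z. 1 \<partial>\<kappa> b \<partial>\<kappa> x \<partial>\<rho> x \<partial>\<mu>)"
  proof (intro nn_integral_mono)
    fix x b y z
    have "ennreal (weight x b) * h y \<le> 1 * 1"
      using weight_le_1[of x b] h1[of y] by (intro mult_mono) (auto simp: ennreal_le_1)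
    then show "(if 0 < gain x y z then ennreal (weight x b) * h y else 0) \<le> 1" by simp
  qed
  also have "\<dots> = 1"
    using one \<mu>.emeasure_space_1 by (simp add: space_\<kappa> space_\<rho>)
  finally have "(\<integral>\<^sup>+x. ?out x \<partial>\<mu>) \<noteq> \<infinity>"
    by (auto simp: top_unique)
  with eq show ?thesis by (simp add: ennreal_add_left_cancel)
qed

section \<open>Transport cost and mean of the exchanged kernel\<close>

definition exchanged :: "real \<Rightarrow> real measure" where
  "exchanged x = distr (exchange x) borel snd"

lemma exchange_prob: "prob_space (exchange x)" and sets_exchange: "sets (exchange x) = sets borel"
  using exchange_kernel[THEN measurable_space, of x] by (auto simp: space_prob_algebra borel_prod)

lemma exchange_proj: "fst \<in> exchange x \<rightarrow>\<^sub>M borel" "snd \<in> exchange x \<rightarrow>\<^sub>M borel"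
  by (simp_all add: measurable_cong_sets[OF sets_exchange refl])

lemma exchanged_kernel [measurable]: "exchanged \<in> borel \<rightarrow>\<^sub>M prob_algebra borel"
  unfolding exchanged_def[abs_def] by measurable

lemma exchange_couplings: "exchange x \<in> couplings (\<kappa> x) (exchanged x)"
proof -
  have "distr (exchange x) borel fst = \<kappa> x"
  proof (rule measure_eqI)
    fix A assume "A \<in> sets (distr (exchange x) borel fst)"
    then have A[measurable]: "A \<in> sets borel" by simp
    have "emeasure (distr (exchange x) borel fst) A = (\<integral>\<^sup>+p. indicator A (fst p) \<partial>exchange x)"
      using A nn_integral_distr[OF exchange_proj(1), of "indicator A" x] by simp
    also have "\<dots> = (\<integral>\<^sup>+y. indicator A y \<partial>\<kappa> x)"
      by (rule nn_integral_exchange_fst) simp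
    also have "\<dots> = emeasure (\<kappa> x) A"
      using A by (simp add: sets_\<kappa>)
    finally show "emeasure (distr (exchange x) borel fst) A = emeasure (\<kappa> x) A" .
  qed (simp add: sets_\<kappa>)
  then show ?thesis
    by (simp add: couplings_def exchange_prob sets_exchange exchanged_def)
qed

text \<open>The cost is the modulus of the gain, and the gain is almost surely nonnegative under
  \<open>exchange x\<close>; so the cost of this coupling equals the change of the mean.\<close>

lemma wasserstein1_exchanged_le:
  assumes "drift x \<noteq> 0 \<longrightarrow> (AE b in \<rho> x. opposed x b)"
  shows "wasserstein1 (\<kappa> x) (exchanged x) \<le> ennreal \<bar>drift x\<bar>"
proof -
  have m: "(\<lambda>p. ennreal (gain x (fst p) (snd p))) \<in> borel_measurable (exchange x)"
    "(\<lambda>p. ennreal (- gain x (fst p) (snd p))) \<in> borel_measurable (exchange x)"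
    using exchange_proj[of x] by measurable
  have "ennreal \<bar>y - z\<bar> = ennreal (gain x y z) + ennreal (- gain x y z)" for y z
    by (cases "gain x y z \<ge> 0") (auto simp: gain_def ennreal_neg split: if_splits)
  then have "(\<integral>\<^sup>+(y, z). ennreal \<bar>y - z\<bar> \<partial>exchange x) = ennreal \<bar>drift x\<bar>"
    using nn_integral_gain_exchange[OF assms] nn_integral_neg_gain_exchange[OF assms]
    by (simp add: case_prod_unfold nn_integral_add[OF m])
  then show ?thesis
    unfolding wasserstein1_def by (metis (no_types, lifting) INF_lower exchange_couplings)
qed

text \<open>The exchange shifts the mean by \<open>- drift x\<close>. Integrability of
  \<open>\<kappa> x\<close> is a separate hypothesis, because zero drift may be only the default
  value of the integral.\<close>

lemma has_bochner_integral_exchanged: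
  assumes opp: "drift x \<noteq> 0 \<longrightarrow> (AE b in \<rho> x. opposed x b)" and int: "integrable (\<kappa> x) (\<lambda>y. y - x)"
  shows "has_bochner_integral (exchanged x) (\<lambda>y. y - x) 0"
proof -
  define s :: real where "s = (if drift x < 0 then 1 else -1)"
  have gain: "gain x y z = s * (z - y)" for y z
    by (simp add: gain_def s_def)
  have s: "s * s = 1" "s * \<bar>drift x\<bar> = - drift x" by (auto simp: s_def)
  note p = exchange_proj[of x]
  have gm: "(\<lambda>p. gain x (fst p) (snd p)) \<in> borel_measurable (exchange x)"
    using p by measurable
  have gi: "integrable (exchange x) (\<lambda>p. gain x (fst p) (snd p))"
    using gm nn_integral_gain_exchange[OF opp] nn_integral_neg_gain_exchange[OF opp] by (simp add: real_integrable_def)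
  have ge: "(\<integral>p. gain x (fst p) (snd p) \<partial>exchange x) = \<bar>drift x\<bar>"
    unfolding real_lebesgue_integral_def[OF gi] nn_integral_gain_exchange[OF opp] nn_integral_neg_gain_exchange[OF opp]
    by simp
  have f\<kappa>: "distr (exchange x) borel fst = \<kappa> x"
    using exchange_couplings by (simp add: couplings_def)
  have fi: "integrable (exchange x) (\<lambda>p. fst p - x)"
    using int unfolding f\<kappa>[symmetric] by (rule integrable_distr[OF p(1)])
  have fe: "(\<integral>p. fst p - x \<partial>exchange x) = drift x"
    unfolding drift_def f\<kappa>[symmetric] by (rule integral_distr[OF p(1), symmetric]) simp
  \<comment> \<open>Since \<open>s * s = 1\<close>, the displacement is \<open>s\<close> times the
    gain. Its mean \<open>s * \<bar>drift x\<bar> = - drift x\<close> cancels that of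
    \<open>fst p - x\<close>.\<close>
  have eq: "snd p - x = s * gain x (fst p) (snd p) + (fst p - x)" for p
    using s(1) by (simp add: gain mult.assoc[symmetric])
  have "integrable (exchange x) (\<lambda>p. snd p - x)"
    unfolding eq using gi fi by (intro Bochner_Integration.integrable_add) auto
  moreover have "(\<integral>p. snd p - x \<partial>exchange x) = 0"
    unfolding eq using gi fi by (subst Bochner_Integration.integral_add) (auto simp: fe ge s)
  ultimately show ?thesis
    unfolding exchanged_def has_bochner_integral_iff
    using integrable_distr_eq[OF p(2), of "\<lambda>y. y - x"] integral_distr[OF p(2), of "\<lambda>y. y - x"] by simp
qed

end

subsection \<open>The martingale rearrangement\<close>

theorem proposition2p4:
  fixes \<mu> \<nu> :: "real measure" and \<pi> :: "(real \<times> real) measure"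
  assumes "\<mu> \<in> P1" and "\<nu> \<in> P1"
    and "convex_order \<mu> \<nu>"
    and "\<pi> \<in> couplings \<mu> \<nu>"
    and "barycentre_dispersion \<pi>"
  shows "\<exists>\<pi>_mr \<in> martingale_couplings \<mu> \<nu>.
    (INF \<pi>'\<in>martingale_couplings \<mu> \<nu>. nested_wasserstein1 \<pi> \<pi>') = nested_wasserstein1 \<pi> \<pi>_mr \<and>
    nested_wasserstein1 \<pi> \<pi>_mr = barycentre_gap \<pi>"
proof -
  note \<mu> = P1D[OF assms(1)] and \<pi> = couplingsD[OF assms(4)]
  interpret \<mu>: prob_space \<mu> by (rule \<mu>(1))
  define \<kappa> where "\<kappa> = disint \<pi>"
  have d: "is_disintegration \<pi> \<kappa>"
    unfolding \<kappa>_def by (rule is_disintegration_disint[OF \<pi>(1,2)])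
  note k = is_disintegrationD[OF d]
  define b where "b x = (\<integral>y. y - x \<partial>\<kappa> x)" for x
  note inc = integrable_increment[OF assms(1,2,4)]
  have b_meas: "b \<in> borel_measurable borel"
    unfolding b_def[abs_def]
    using borel_measurable_kernel_integral[OF _ k(1), of "\<lambda>z. snd z - fst z"] by simp
  have int: "AE x in \<mu>. integrable (\<kappa> x) (\<lambda>y. y - x)"
    using AE_integrable_is_disintegration[OF d \<pi>(1,2) inc(1)] unfolding \<pi>(3) by simp
  have b_int: "integrable \<mu> b"
    using integrable_is_disintegration[OF d \<pi>(1,2) inc(1)] unfolding \<pi>(3) b_def[abs_def] by simp
  \<comment> \<open>The convex order enters through the equality of the means of
    \<open>\<mu>\<close> and \<open>\<nu>\<close>, which makes the total drift vanish.\<close>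
  have b_0: "(\<integral>x. b x \<partial>\<mu>) = 0"
    using integral_is_disintegration[OF d \<pi>(1,2) inc(1)] inc(2) convex_order_mean_eq[OF assms(1-3)]
    unfolding \<pi>(3) b_def[abs_def] by simp
  \<comment> \<open>Dispersion in terms of the drift: the indicator depends on the first coordinate
    alone, so it leaves the fibre integral.\<close>
  have tail: "0 \<le> (\<integral>x. indicator {t..} x * b x \<partial>\<mu>)" for t
  proof -
    let ?f = "\<lambda>z. indicator {z. t \<le> fst z} z * (snd z - fst z) :: real"
    have S: "{z. t \<le> fst z} \<in> sets \<pi>" unfolding \<pi>(2) by measurable
    have f: "integrable \<pi> ?f"
      using integrable_real_mult_indicator[OF S inc(1)] by (simp add: mult.commute)
    have "0 \<le> (\<integral>z. ?f z \<partial>\<pi>)"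
      using assms(5) unfolding barycentre_dispersion_def set_lebesgue_integral_def by simp
    also have "\<dots> = (\<integral>x. \<integral>y. ?f (x, y) \<partial>\<kappa> x \<partial>\<mu>)"
      using integral_is_disintegration[OF d \<pi>(1,2) f] unfolding \<pi>(3) by simp
    also have "\<dots> = (\<integral>x. indicator {t..} x * b x \<partial>\<mu>)"
      unfolding b_def by (intro Bochner_Integration.integral_cong refl) (simp add: indicator_def)
    finally show ?thesis .
  qed
  obtain \<rho> where \<rho>: "\<rho> \<in> borel \<rightarrow>\<^sub>M prob_algebra borel"
    and sym: "\<And>f. f \<in> borel_measurable borel \<Longrightarrow> (\<integral>\<^sup>+x. ennreal \<bar>b x\<bar> * (\<integral>\<^sup>+y. f (x, y) \<partial>\<rho> x) \<partial>\<mu>) =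
        (\<integral>\<^sup>+x. ennreal \<bar>b x\<bar> * (\<integral>\<^sup>+y. f (y, x) \<partial>\<rho> x) \<partial>\<mu>)"
    and supp: "AE x in \<mu>. b x \<noteq> 0 \<longrightarrow> (AE y in \<rho> x. (b x < 0 \<and> 0 < b y \<and> x \<le> y) \<or> (0 < b x \<and> b y < 0 \<and> y \<le> x))"
    using symmetric_partner_kernel_exists[OF \<mu>(1,2) b_meas b_int b_0 tail] by blast
  interpret X: kernel_exchange \<kappa> \<rho>
    using k(1) \<rho> by unfold_locales
  have b: "X.drift = b" by (simp add: X.drift_def b_def fun_eq_iff)
  have opp: "AE x in \<mu>. X.drift x \<noteq> 0 \<longrightarrow> (AE y in \<rho> x. X.opposed x y)"
    using supp unfolding X.opposed_def b .
  obtain \<pi>' where \<pi>': "prob_space \<pi>'" "sets \<pi>' = sets borel" "distr \<pi>' borel fst = \<mu>"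
      and d': "is_disintegration \<pi>' X.exchanged"
      and \<pi>'_snd: "\<And>B. B \<in> sets borel \<Longrightarrow> emeasure (distr \<pi>' borel snd) B = (\<integral>\<^sup>+x. emeasure (X.exchanged x) B \<partial>\<mu>)"
    using disintegrated_measure_exists[OF \<mu>(1,2) X.exchanged_kernel] by blast
  have "distr \<pi>' borel snd = \<nu>"
  proof (rule measure_eqI)
    fix B assume "B \<in> sets (distr \<pi>' borel snd)"
    then have B[measurable]: "B \<in> sets borel" by simp
    have "emeasure (distr \<pi>' borel snd) B = (\<integral>\<^sup>+x. \<integral>\<^sup>+p. indicator B (snd p) \<partial>X.exchange x \<partial>\<mu>)"
      using nn_integral_distr[OF X.exchange_proj(2), of "indicator B"] B
      by (simp add: \<pi>'_snd X.exchanged_def)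
    also have "\<dots> = (\<integral>\<^sup>+x. \<integral>\<^sup>+y. indicator B y \<partial>\<kappa> x \<partial>\<mu>)"
      by (rule X.nn_integral_exchange_snd[OF \<mu>(1,2) sym[folded b] opp]) (auto simp: indicator_def)
    also have "\<dots> = (\<integral>\<^sup>+z. indicator B (snd z) \<partial>\<pi>)"
      using nn_integral_is_disintegration[OF d \<pi>(1,2), of "\<lambda>z. indicator B (snd z)"] by (simp add: \<pi>(3))
    also have "\<dots> = emeasure \<nu> B"
      using nn_integral_distr[OF \<pi>(6), of "indicator B"] B P1D(2)[OF assms(2)] by (simp add: \<pi>(4))
    finally show "emeasure (distr \<pi>' borel snd) B = emeasure \<nu> B" .
  qed (simp add: P1D(2)[OF assms(2)])
  with \<pi>' have c': "\<pi>' \<in> couplings \<mu> \<nu>" by (simp add: couplings_def)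
  \<comment> \<open>\<open>disint \<pi>'\<close> is an arbitrary choice, so the properties of the
    constructed kernel reach it through almost sure uniqueness.\<close>
  have eq: "AE x in \<mu>. disint \<pi>' x = X.exchanged x"
    using is_disintegration_unique[OF is_disintegration_disint[OF \<pi>'(1,2)] d' \<pi>'(1,2)] unfolding \<pi>'(3) .
  have m': "\<pi>' \<in> martingale_couplings \<mu> \<nu>"
    unfolding martingale_couplings_def
  proof (intro CollectI conjI c')
    show "AE x in \<mu>. has_bochner_integral (disint \<pi>' x) (\<lambda>y. y - x) 0"
      using eq opp int by eventually_elim (simp add: X.has_bochner_integral_exchanged)
  qed
  have le: "nested_wasserstein1 \<pi> \<pi>' \<le> barycentre_gap \<pi>"
  proof -
    have W: "AE x in \<mu>. wasserstein1 (disint \<pi> x) (disint \<pi>' x) \<le> ennreal \<bar>b x\<bar>"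
      using eq opp
    proof eventually_elim
      case (elim x)
      have "wasserstein1 (\<kappa> x) (X.exchanged x) \<le> ennreal \<bar>b x\<bar>"
        using X.wasserstein1_exchanged_le[OF elim(2)] by (simp only: b)
      then show ?case unfolding elim(1) \<kappa>_def .
    qed
    \<comment> \<open>The set where the bound fails is not known to be measurable. A measurable null
      set covering it allows the bound to be carried over to the diagonal coupling.\<close>
    then obtain N where N: "N \<in> null_sets \<mu>"
      "{x \<in> space \<mu>. \<not> wasserstein1 (disint \<pi> x) (disint \<pi>' x) \<le> ennreal \<bar>b x\<bar>} \<subseteq> N"
      by (auto simp: eventually_ae_filter)
    have sp: "space \<mu> = UNIV" using \<mu>(2) by (simp add: sets_eq_imp_space_eq)
    have Nb[measurable]: "N \<in> sets borel" using N(1) \<mu>(2) by auto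
    \<comment> \<open>The diagonal coupling leaves the first coordinate in place, so the whole cost
      lies in the second stage.\<close>
    let ?\<gamma> = "distr \<mu> borel (\<lambda>x. (x, x))"
    have diag: "(\<lambda>x. (x, x)) \<in> \<mu> \<rightarrow>\<^sub>M borel"
      unfolding borel_prod[symmetric] by (simp add: measurable_cong_sets[OF \<mu>(2) refl])
    have id: "distr \<mu> borel (\<lambda>x. x) = \<mu>"
      using distr_id2[of borel \<mu>] \<mu>(2) by simp
    have \<gamma>: "?\<gamma> \<in> couplings (distr \<pi> borel fst) (distr \<pi>' borel fst)"
      unfolding \<pi>(3) \<pi>'(3) couplings_def using \<mu>.prob_space_distr[OF diag]
      by (simp add: distr_distr[OF measurable_fst_borel diag] distr_distr[OF measurable_snd_borel diag] comp_def id)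
    have "AE z in ?\<gamma>. fst z = snd z \<and> fst z \<notin> N"
    proof (subst AE_distr_iff[OF diag])
      show "{z \<in> space borel. fst z = snd z \<and> fst z \<notin> N} \<in> sets (borel :: (real \<times> real) measure)"
        by measurable
      show "AE x in \<mu>. fst (x, x) = snd (x, x) \<and> fst (x, x) \<notin> N"
        using AE_not_in[OF N(1)] by simp
    qed
    then have "AE z in ?\<gamma>. wasserstein1 (disint \<pi> (fst z)) (disint \<pi>' (snd z)) \<le> ennreal \<bar>b (fst z)\<bar>"
      by eventually_elim (use N(2) sp in auto)
    then have "(\<integral>\<^sup>+z. wasserstein1 (disint \<pi> (fst z)) (disint \<pi>' (snd z)) \<partial>?\<gamma>) \<le> (\<integral>\<^sup>+z. ennreal \<bar>b (fst z)\<bar> \<partial>?\<gamma>)"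
      by (rule nn_integral_mono_AE)
    also have "\<dots> = (\<integral>\<^sup>+x. ennreal \<bar>b x\<bar> \<partial>\<mu>)"
      using b_meas by (subst nn_integral_distr[OF diag]) auto
    also have "\<dots> = barycentre_gap \<pi>"
      unfolding barycentre_gap_def b_def \<kappa>_def \<pi>(3) ..
    finally have W1: "(\<integral>\<^sup>+(x, y). wasserstein1 (disint \<pi> x) (disint \<pi>' y) \<partial>?\<gamma>) \<le> barycentre_gap \<pi>"
      by (simp add: case_prod_unfold)
    have 0: "(\<integral>\<^sup>+(x, y). ennreal \<bar>x - y\<bar> \<partial>?\<gamma>) = 0"
      by (subst nn_integral_distr[OF diag]) (auto simp: case_prod_unfold)
    show ?thesis
      unfolding nested_wasserstein1_def by (rule INF_lower2[OF \<gamma>]) (use W1 0 in simp)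
  qed
  note ge = barycentre_gap_le_nested_wasserstein1[OF assms(1,2,4)]
  have "nested_wasserstein1 \<pi> \<pi>' = barycentre_gap \<pi>"
    using le ge[OF m'] by (rule antisym)
  moreover have "(INF \<pi>'\<in>martingale_couplings \<mu> \<nu>. nested_wasserstein1 \<pi> \<pi>') = barycentre_gap \<pi>"
    \<comment> \<open>The lower bound holds for every competitor and \<open>\<pi>'\<close> attains
      it, so the infimum is a minimum.\<close>
    using le m' by (intro antisym INF_greatest ge) (auto intro: INF_lower2)
  ultimately show ?thesis using m' by (intro bexI[of _ \<pi>'] conjI) simp_all
qed

end
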